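(* Let $1\le p\le\infty$ and $\frac1p+\frac1q=1$. Let $\sigma\in L^1_\alpha(\mathcal X)$, $\psi\in L^p_\alpha(\mathbb R^{d+1}_+)$ and $\varphi\in L^q_\alpha(\mathbb R^{d+1}_+)$. Then the two-wavelet localization operator $\mathcal L_{\varphi,\psi}(\sigma)$ is a bounded linear operator from $L^p_\alpha(\mathbb R^{d+1}_+)$ into itself, and $$\|\mathcal L_{\varphi,\psi}(\sigma)\|_{\mathcal B(L^p_\alpha(\mathbb R^{d+1}_+))}\le \|\varphi\|_{\alpha,q}\,\|\psi\|_{\alpha,p}\,\|\sigma\|_{L^1_\alpha(\mathcal X)}.$$
   Context: Fix an integer $d\ge 1$ and a real $\alpha>-1/2$. Let $\mathbb R^{d+1}_+=\mathbb R^d\times(0,\infty)$, with points $x=(x',x_{d+1})$, equipped with the measure $$d\mu_\alpha(x)=\frac{x_{d+1}^{2\alpha+1}}{(2\pi)^d2^{2\alpha}\Gamma^2(\alpha+1)}\,dx.$$ For $1\le p\le\infty$, $L^p_\alpha(\mathbb R^{d+1}_+)$ is the $L^p$ space of complex-valued functions for $\mu_\alpha$, with norm $\|\cdot\|_{\alpha,p}$; $\mathcal B(E)$ denotes the bounded linear operators on a Banach space $E$ and $\|\cdot\|_{\mathcal B(E)}$ the operator norm. Let $\mathcal X=\{(a,x): a>0,\ x\in\mathbb R^{d+1}_+\}$ with measure $d\mu_\alpha(a,x)=\frac{d\mu_\alpha(x)\,da}{a^{2\alpha+d+3}}$, and $L^p_\alpha(\mathcal X)$ the corresponding $L^p$ space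 with norm $\|\cdot\|_{L^p_\alpha(\mathcal X)}$. Generalized translation, for $x,y\in\mathbb R^{d+1}_+$: $$\tau^\alpha_x\varphi(y)=\frac{\Gamma(\alpha+1)}{\sqrt\pi\,\Gamma(\alpha+1/2)}\int_0^\pi\varphi\Big(x'+y',\sqrt{x_{d+1}^2+y_{d+1}^2+2x_{d+1}y_{d+1}\cos\theta}\Big)(\sin\theta)^{2\alpha}\,d\theta;$$ it extends to a contraction on every $L^p_\alpha(\mathbb R^{d+1}_+)$. For $a>0$ put $\varphi_a(x)=a^{-(2\alpha+d+2)}\varphi(x/a)$ and $\varphi_{a,x}(y)=a^{\alpha+1+\frac d2}\,\tau^\alpha_x\varphi_a(y)$. Weinstein continuous wavelet transform (for $f$ and $\varphi$ in Lebesgue spaces with conjugate exponents): $$\Phi^W_\varphi(f)(a,x)=\int_{\mathbb R^{d+1}_+}f(y)\,\overline{\varphi_{a,x}(y)}\,d\mu_\alpha(y),\quad (a,x)\in\mathcal X.$$ Two-wavelet localization operator with symbol $\sigma$ (measurable on $\mathcal X$) and windows $\varphi,\psi$ (measurable on $\mathbb R^{d+1}_+$): $$\mathcal L_{\varphi,\psi}(\sigma)(f)(y)=\int_{\mathcal X}\sigma(a,x)\,\Phi^W_\varphi(f)(a,x)\,\psi_{a,x}(y)\,d\mu_\alpha(a,x),\quad y\in\mathbb R^{d+1}_+.$$ *)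

theory Defs
  imports "HOL-Probability.Essential_Supremum"
begin

section \<open>Lebesgue spaces with exponent in [1, \<infinity>]\<close>

text \<open>
  The elements of L^p are represented by measurable functions; functions that are equal almost
  everywhere represent the same element. For \<open>p < \<infinity>\<close> the second branch spells out
  the p-th root of the integral, since \<open>powr\<close> is not available on \<^typ>\<open>ennreal\<close>.
\<close>

definition Lp_norm :: "'a measure \<Rightarrow> ennreal \<Rightarrow> ('a \<Rightarrow> complex) \<Rightarrow> ennreal" where
  "Lp_norm M p f =
    (if p = \<infinity> then esssup M (\<lambda>x. ennreal (norm (f x)))
     else let I = (\<integral>\<^sup>+ x. ennreal (norm (f x) powr enn2real p) \<partial>M)
          in if I = \<infinity> then \<infinity> else ennreal (enn2real I powr (1 / enn2real p)))"

definition Lp :: "'a measure \<Rightarrow> ennreal \<Rightarrow> ('a \<Rightarrow> complex) set" where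
  "Lp M p = {f \<in> borel_measurable M. Lp_norm M p f < \<infinity>}"

text \<open>
  A map on functions is a linear operator of L^p into itself if it preserves membership in L^p,
  descends to classes modulo equality almost everywhere, and is linear on these classes.
\<close>

definition Lp_linear_operator ::
    "'a measure \<Rightarrow> ennreal \<Rightarrow> (('a \<Rightarrow> complex) \<Rightarrow> ('a \<Rightarrow> complex)) \<Rightarrow> bool" where
  "Lp_linear_operator M p T \<longleftrightarrow>
    (\<forall>f\<in>Lp M p. T f \<in> Lp M p) \<and>
    (\<forall>f\<in>Lp M p. \<forall>g\<in>Lp M p. (AE x in M. f x = g x) \<longrightarrow> (AE x in M. T f x = T g x)) \<and>
    (\<forall>f\<in>Lp M p. \<forall>g\<in>Lp M p. AE x in M. T (\<lambda>y. f y + g y) x = T f x + T g x) \<and>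
    (\<forall>f\<in>Lp M p. \<forall>c. AE x in M. T (\<lambda>y. c * f y) x = c * T f x)"

definition Lp_bounded_linear_operator ::
    "'a measure \<Rightarrow> ennreal \<Rightarrow> (('a \<Rightarrow> complex) \<Rightarrow> ('a \<Rightarrow> complex)) \<Rightarrow> bool" where
  "Lp_bounded_linear_operator M p T \<longleftrightarrow>
    Lp_linear_operator M p T \<and>
    (\<exists>C::real. \<forall>f\<in>Lp M p. Lp_norm M p (T f) \<le> ennreal C * Lp_norm M p f)"

definition Lp_operator_norm ::
    "'a measure \<Rightarrow> ennreal \<Rightarrow> (('a \<Rightarrow> complex) \<Rightarrow> ('a \<Rightarrow> complex)) \<Rightarrow> ennreal" where
  "Lp_operator_norm M p T = (SUP f\<in>{f \<in> Lp M p. Lp_norm M p f \<le> 1}. Lp_norm M p (T f))"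


section \<open>The half-space and its measures\<close>

text \<open>
  Points of R^(d+1) are pairs \<open>(x', x_{d+1})\<close>, with \<open>d = CARD('d) \<ge> 1\<close>. The measures live on the
  Borel sets of the open half-space.
\<close>

type_synonym 'd hpoint = "(real ^ 'd) \<times> real"

definition half_space :: "'d::finite hpoint set" where
  "half_space = {x. 0 < snd x}"

definition weinstein_measure :: "real \<Rightarrow> 'd::finite hpoint measure" where
  "weinstein_measure \<alpha> = density (restrict_space lborel half_space)
    (\<lambda>x. ennreal (snd x powr (2 * \<alpha> + 1) /
        ((2 * pi) ^ CARD('d) * 2 powr (2 * \<alpha>) * (Gamma (\<alpha> + 1))\<^sup>2)))"

definition weinstein_scale_measure :: "real \<Rightarrow> (real \<times> 'd::finite hpoint) measure" where
  "weinstein_scale_measure \<alpha> =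
    density (restrict_space lborel {0<..} \<Otimes>\<^sub>M weinstein_measure \<alpha>)
      (\<lambda>(a, x). ennreal (1 / a powr (2 * \<alpha> + real CARD('d) + 3)))"


section \<open>Translation, wavelet transform and localization operator\<close>

definition weinstein_translation ::
    "real \<Rightarrow> 'd::finite hpoint \<Rightarrow> ('d hpoint \<Rightarrow> complex) \<Rightarrow> 'd hpoint \<Rightarrow> complex" where
  "weinstein_translation \<alpha> x \<phi> y =
    complex_of_real (Gamma (\<alpha> + 1) / (sqrt pi * Gamma (\<alpha> + 1 / 2))) *
    (LBINT \<theta>=0..pi.
       \<phi> (fst x + fst y, sqrt ((snd x)\<^sup>2 + (snd y)\<^sup>2 + 2 * snd x * snd y * cos \<theta>)) *
       complex_of_real (sin \<theta> powr (2 * \<alpha>)))"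

definition weinstein_dilation ::
    "real \<Rightarrow> real \<Rightarrow> ('d::finite hpoint \<Rightarrow> complex) \<Rightarrow> 'd hpoint \<Rightarrow> complex" where
  "weinstein_dilation \<alpha> a \<phi> x =
    complex_of_real (a powr (- (2 * \<alpha> + real CARD('d) + 2))) * \<phi> (x /\<^sub>R a)"

definition weinstein_atom ::
    "real \<Rightarrow> ('d::finite hpoint \<Rightarrow> complex) \<Rightarrow> real \<Rightarrow> 'd hpoint \<Rightarrow> 'd hpoint \<Rightarrow> complex" where
  "weinstein_atom \<alpha> \<phi> a x y =
    complex_of_real (a powr (\<alpha> + 1 + real CARD('d) / 2)) *
    weinstein_translation \<alpha> x (weinstein_dilation \<alpha> a \<phi>) y"

definition weinstein_wavelet_transform ::
    "real \<Rightarrow> ('d::finite hpoint \<Rightarrow> complex) \<Rightarrow> ('d hpoint \<Rightarrow> complex) \<Rightarrow> real \<times> 'd hpoint \<Rightarrow> complex" where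
  "weinstein_wavelet_transform \<alpha> \<phi> f =
    (\<lambda>(a, x). \<integral>y. f y * cnj (weinstein_atom \<alpha> \<phi> a x y) \<partial>weinstein_measure \<alpha>)"

definition localization_integrand ::
    "real \<Rightarrow> ('d::finite hpoint \<Rightarrow> complex) \<Rightarrow> ('d hpoint \<Rightarrow> complex) \<Rightarrow>
     (real \<times> 'd hpoint \<Rightarrow> complex) \<Rightarrow> ('d hpoint \<Rightarrow> complex) \<Rightarrow> 'd hpoint \<Rightarrow>
     real \<times> 'd hpoint \<Rightarrow> complex" where
  "localization_integrand \<alpha> \<phi> \<psi> \<sigma> f y =
    (\<lambda>(a, x). \<sigma> (a, x) * weinstein_wavelet_transform \<alpha> \<phi> f (a, x) * weinstein_atom \<alpha> \<psi> a x y)"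

definition localization_operator ::
    "real \<Rightarrow> ('d::finite hpoint \<Rightarrow> complex) \<Rightarrow> ('d hpoint \<Rightarrow> complex) \<Rightarrow>
     (real \<times> 'd hpoint \<Rightarrow> complex) \<Rightarrow> ('d hpoint \<Rightarrow> complex) \<Rightarrow> 'd hpoint \<Rightarrow> complex" where
  "localization_operator \<alpha> \<phi> \<psi> \<sigma> f y =
    (\<integral>z. localization_integrand \<alpha> \<phi> \<psi> \<sigma> f y z \<partial>weinstein_scale_measure \<alpha>)"

end

theory Submission
  imports Defs
begin

text \<open>
  The localization operator is a superposition: \<open>L f = \<integral> \<sigma> z * \<langle>f, \<phi>\<^sub>z\<rangle> * \<psi>\<^sub>z dz\<close>, where \<open>z = (a, x)\<close>
  runs over scales and positions and \<open>\<phi>\<^sub>z\<close>, \<open>\<psi>\<^sub>z\<close> are the atoms of the two windows. By the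
  Hoelder inequality each rank-one operator \<open>f \<mapsto> \<langle>f, \<phi>\<^sub>z\<rangle> * \<psi>\<^sub>z\<close> has norm at most
  \<open>\<parallel>\<phi>\<^sub>z\<parallel>\<^sub>q * \<parallel>\<psi>\<^sub>z\<parallel>\<^sub>p\<close> on \<open>L\<^sup>p\<close>. If this product is at most \<open>K\<close> for all \<open>z\<close>, then integrating
  against the finite measure \<open>|\<sigma> z| dz\<close> costs only its total mass, so that \<open>L\<close> has norm at most
  \<open>\<parallel>\<sigma>\<parallel>\<^sub>1 * K\<close>, and the integral defining \<open>L f y\<close> converges for almost every \<open>y\<close>. This argument
  concerns arbitrary kernels on \<open>\<sigma>\<close>-finite spaces (\<open>Lp_norm_superposition_le\<close>); it rests on Hoelder
  (\<open>Hoelder_inequality\<close>) and on the Jensen-type bound \<open>Lp_norm_integral_le\<close>.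

  What remains is the uniform bound \<open>\<parallel>\<phi>\<^sub>z\<parallel>\<^sub>q * \<parallel>\<psi>\<^sub>z\<parallel>\<^sub>p \<le> \<parallel>\<phi>\<parallel>\<^sub>q * \<parallel>\<psi>\<parallel>\<^sub>p\<close>. The measure on the half-space is
  homogeneous of degree \<open>\<kappa> = 2\<alpha> + d + 2\<close>, so the normalization of the atoms multiplies the \<open>L\<^sup>p\<close> norm by
  \<open>a powr (\<kappa> / p - \<kappa> / 2)\<close>; for conjugate exponents the two powers of \<open>a\<close> cancel. The translation is
  a contraction on every \<open>L\<^sup>p\<close>: it is the average of \<open>\<phi>\<close> over the random point
  \<open>(x' + y', sqrt (x\<^sup>2 + y\<^sup>2 + 2 x y cos \<theta>))\<close>, with \<open>x\<close> and \<open>y\<close> in the root standing for the last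
  coordinates, and when \<open>y\<close> is distributed according to the measure of the
  half-space and \<open>\<theta>\<close> according to the normalized weight \<open>sin \<theta> powr 2\<alpha>\<close>, that point is again
  distributed according to the measure of the half-space (\<open>nn_integral_translated_point\<close>).

  The last fact is plane geometry. In the upper half-plane with coordinates
  \<open>(u, v) = (y cos \<theta>, y sin \<theta>)\<close>, the measure \<open>y powr (2\<alpha> + 1) * sin \<theta> powr 2\<alpha> dy d\<theta>\<close> is
  \<open>v powr 2\<alpha> du dv\<close>, which is invariant under shifts of \<open>u\<close>, and the square root above is the distance
  of \<open>(u + x, v)\<close> from the origin. The same polar coordinates, applied to
  \<open>v powr 2\<alpha> * exp (- u\<^sup>2 - v\<^sup>2)\<close>, show that the constant in the definition of the translation turns the
  angular weight into a probability measure.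
\<close>

section \<open>Polar coordinates in the upper half-plane\<close>

text \<open>
  Both sides are integrals of \<open>F\<close> against a measure on the line, so it suffices to compare these
  measures on Borel sets, where the change of variables for absolutely integrable real functions
  applies to indicator functions.
\<close>

lemma nn_integral_change_of_variables:
  fixes g g' :: "real \<Rightarrow> real" and F :: "real \<Rightarrow> ennreal"
  assumes [measurable]: "S \<in> sets borel" "T \<in> sets borel" "g \<in> borel_measurable borel"
      "g' \<in> borel_measurable borel" "F \<in> borel_measurable borel"
    and der: "\<And>x. x \<in> S \<Longrightarrow> (g has_field_derivative g' x) (at x)"
    and bij: "bij_betw g S T"
  shows "(\<integral>\<^sup>+x. indicator S x * ennreal \<bar>g' x\<bar> * F (g x) \<partial>lborel) = (\<integral>\<^sup>+y. indicator T y * F y \<partial>lborel)"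
proof -
  have inj: "inj_on g S" and im: "g ` S = T"
    using bij by (auto simp: bij_betw_def)
  define M1 where "M1 = distr (density lborel (\<lambda>x. indicator S x * ennreal \<bar>g' x\<bar>)) borel g"
  define M2 where "M2 = density lborel (indicator T :: real \<Rightarrow> ennreal)"
  have "M1 = M2"
  proof (rule measure_eqI)
    show "sets M1 = sets M2" by (simp add: M1_def M2_def)
    fix A assume "A \<in> sets M1"
    then have A[measurable]: "A \<in> sets borel" by (simp add: M1_def)
    have [measurable]: "g -` A \<in> sets borel"
      using measurable_sets[of g borel borel A] by simp
    define u where "u = (\<lambda>x. indicator S x *\<^sub>R (\<bar>g' x\<bar> * indicator A (g x)) :: real)"
    define v where "v = (\<lambda>x. indicator T x *\<^sub>R (indicator A x) :: real)"
    have [measurable]: "u \<in> borel_measurable borel" "v \<in> borel_measurable borel"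
      unfolding u_def v_def by measurable
    have nn: "u x \<ge> 0" "v x \<ge> 0" for x by (auto simp: u_def v_def)
    have cov: "(\<lambda>x. \<bar>g' x\<bar> * indicator A (g x)) absolutely_integrable_on S \<and>
           integral S (\<lambda>x. \<bar>g' x\<bar> * indicator A (g x)) = b
     \<longleftrightarrow> (indicator A :: real \<Rightarrow> real) absolutely_integrable_on T \<and> integral T (indicator A) = b" for b
      using has_absolute_integral_change_of_variables_1'[of S g g' "indicator A" b] der inj
      by (auto simp: im has_field_derivative_at_within)
    have iu: "(\<lambda>x. \<bar>g' x\<bar> * indicator A (g x)) absolutely_integrable_on S \<longleftrightarrow> integrable lborel u"
      unfolding set_integrable_def u_def[symmetric] by (simp add: integrable_completion)
    have iv: "(indicator A :: real \<Rightarrow> real) absolutely_integrable_on T \<longleftrightarrow> integrable lborel v"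
      unfolding set_integrable_def v_def[symmetric] by (simp add: integrable_completion)
    have eq: "integral\<^sup>L lborel u = integral\<^sup>L lborel v" if "integrable lborel u" "integrable lborel v"
    proof -
      have "integral\<^sup>L lborel u = integral S (\<lambda>x. \<bar>g' x\<bar> * indicator A (g x))"
        using set_lebesgue_integral_eq_integral(2)[OF that(1)[folded iu]]
        unfolding set_lebesgue_integral_def u_def[symmetric] by (simp add: integral_completion)
      moreover have "integral\<^sup>L lborel v = integral T (indicator A)"
        using set_lebesgue_integral_eq_integral(2)[OF that(2)[folded iv]]
        unfolding set_lebesgue_integral_def v_def[symmetric] by (simp add: integral_completion)
      ultimately show ?thesis using cov iu iv that by metis
    qed
    have "(\<integral>\<^sup>+x. ennreal (u x) \<partial>lborel) = (\<integral>\<^sup>+x. ennreal (v x) \<partial>lborel)"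
    proof (cases "integrable lborel u")
      case True
      then have "integrable lborel v" using cov iu iv by blast
      with True show ?thesis using eq by (simp add: nn_integral_eq_integral nn)
    next
      case False
      then have "\<not> integrable lborel v" using cov iu iv by blast
      have "integrable lborel w" if "w \<in> borel_measurable borel" "\<And>x. w x \<ge> 0" "(\<integral>\<^sup>+x. ennreal (w x)
          \<partial>lborel) < \<infinity>"
        for w :: "real \<Rightarrow> real"
        using that by (intro integrableI_nonneg AE_I2) simp_all
      then have "\<not> (\<integral>\<^sup>+x. ennreal (u x) \<partial>lborel) < \<infinity>" "\<not> (\<integral>\<^sup>+x. ennreal (v x) \<partial>lborel) < \<infinity>"
        using False \<open>\<not> integrable lborel v\<close> nn \<open>u \<in> borel_measurable borel\<close> \<open>v \<in> borel_measurable borel\<close>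
            by metis+
      then show ?thesis by (metis infinity_ennreal_def top.not_eq_extremum)
    qed
    moreover have "emeasure M1 A = (\<integral>\<^sup>+x. ennreal (u x) \<partial>lborel)"
      unfolding M1_def
      by (subst emeasure_distr, simp, simp, subst emeasure_density)
        (auto intro!: nn_integral_cong simp: u_def split: split_indicator)
    moreover have "emeasure M2 A = (\<integral>\<^sup>+x. ennreal (v x) \<partial>lborel)"
      unfolding M2_def
      by (subst emeasure_density) (auto intro!: nn_integral_cong simp: v_def split: split_indicator)
    ultimately show "emeasure M1 A = emeasure M2 A" by simp
  qed
  then have "(\<integral>\<^sup>+y. F y \<partial>M1) = (\<integral>\<^sup>+y. F y \<partial>M2)" by simp
  then show ?thesis
    unfolding M1_def M2_def by (simp add: nn_integral_distr nn_integral_density)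
qed

lemma borel_measurable_cot [measurable]: "cot \<in> borel_measurable (borel :: real measure)"
  unfolding cot_def[abs_def] by measurable

lemma nn_integral_cot:
  fixes F :: "real \<Rightarrow> ennreal"
  assumes [measurable]: "F \<in> borel_measurable borel"
  shows "(\<integral>\<^sup>+\<theta>. indicator {0<..<pi} \<theta> * ennreal (1 / (sin \<theta>)\<^sup>2) * F (cot \<theta>) \<partial>lborel) = (\<integral>\<^sup>+w. F w \<partial>lborel)"
proof -
  have bij: "bij_betw cot {0<..<pi} (UNIV::real set)"
  proof (rule bij_betw_byWitness[where f' = "\<lambda>w. pi / 2 - arctan w"])
    show "\<forall>a\<in>{0<..<pi}. pi / 2 - arctan (cot a) = a"
    proof
      fix a :: real assume "a \<in> {0<..<pi}"
      then have "arctan (tan (pi/2 - a)) = pi/2 - a" by (intro arctan_tan) auto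
      then show "pi / 2 - arctan (cot a) = a" by (simp add: tan_cot' )
    qed
    show "\<forall>w\<in>UNIV. cot (pi / 2 - arctan w) = w"
    proof
      fix w :: real
      have "cot (pi / 2 - arctan w) = tan (arctan w)"
        by (simp only: cot_def tan_def sin_diff cos_diff) simp
      then show "cot (pi / 2 - arctan w) = w" by (simp add: tan_arctan)
    qed
    have "0 < pi / 2 - arctan w" "pi / 2 - arctan w < pi" for w :: real
      using arctan_lbound[of w] arctan_ubound[of w] by linarith+
    then show "(\<lambda>w. pi / 2 - arctan w) ` UNIV \<subseteq> {0<..<pi}"
      by (intro image_subsetI) (simp only: greaterThanLessThan_iff)
  qed auto
  have "(\<integral>\<^sup>+x. indicator {0<..<pi} x * ennreal \<bar>- (1 / (sin x)\<^sup>2)\<bar> * F (cot x) \<partial>lborel) 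
     = (\<integral>\<^sup>+y. indicator UNIV y * F y \<partial>lborel)"
  proof (rule nn_integral_change_of_variables[OF _ _ _ _ _ _ bij])
    fix x :: real assume "x \<in> {0<..<pi}"
    then have "sin x \<noteq> 0" using sin_gt_zero by fastforce
    then show "(cot has_real_derivative - (1 / (sin x)\<^sup>2)) (at x)"
      using DERIV_cot[of x] by (simp add: inverse_eq_divide)
  qed measurable
  then show ?thesis by simp
qed

text \<open>
  Polar coordinates are reached through one-dimensional substitutions in the inner integrals:
  \<open>v = r sin \<theta>\<close> at fixed \<open>\<theta>\<close> turns the ray of angle \<open>\<theta>\<close> into \<open>(v cot \<theta>, v)\<close>, then \<open>w = cot \<theta>\<close> at
  fixed \<open>v\<close> sweeps out the whole horizontal line, and \<open>u = v w\<close> restores the Cartesian coordinate.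
\<close>

lemma nn_integral_polar_coordinates:
  fixes G :: "real \<Rightarrow> real \<Rightarrow> ennreal"
  assumes [measurable]: "(\<lambda>(u, v). G u v) \<in> borel_measurable (borel \<Otimes>\<^sub>M borel)"
  shows "(\<integral>\<^sup>+r. \<integral>\<^sup>+\<theta>. indicator {0<..} r * indicator {0<..<pi} \<theta> * ennreal r * G (r * cos \<theta>) (r * sin \<theta>)
      \<partial>lborel \<partial>lborel)
    = (\<integral>\<^sup>+v. \<integral>\<^sup>+u. indicator {0<..} v * G u v \<partial>lborel \<partial>lborel)"
proof -
  have [measurable]: "case_prod G \<in> borel_measurable (lborel \<Otimes>\<^sub>M lborel)"
    using assms by (simp cong: measurable_cong_sets)
  have "(\<integral>\<^sup>+r. \<integral>\<^sup>+\<theta>. indicator {0<..} r * indicator {0<..<pi} \<theta> * ennreal r * G (r * cos \<theta>) (r * sin \<theta>)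
      \<partial>lborel \<partial>lborel)
    = (\<integral>\<^sup>+\<theta>. \<integral>\<^sup>+r. indicator {0<..} r * indicator {0<..<pi} \<theta> * ennreal r * G (r * cos \<theta>) (r * sin \<theta>)
        \<partial>lborel \<partial>lborel)"
    by (rule lborel_pair.Fubini') measurable
  also have "\<dots> = (\<integral>\<^sup>+\<theta>. \<integral>\<^sup>+v. indicator {0<..} v * indicator {0<..<pi} \<theta> * ennreal (v / (sin \<theta>)\<^sup>2)
      * G (v * cot \<theta>) v \<partial>lborel \<partial>lborel)"
  proof (rule nn_integral_cong)
    fix \<theta> :: real
    show "(\<integral>\<^sup>+r. indicator {0<..} r * indicator {0<..<pi} \<theta> * ennreal r * G (r * cos \<theta>) (r * sin \<theta>) \<partial>lborel)
      = (\<integral>\<^sup>+v. indicator {0<..} v * indicator {0<..<pi} \<theta> * ennreal (v / (sin \<theta>)\<^sup>2) * G (v * cot \<theta>) v \<partial>lborel)"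
    proof (cases "\<theta> \<in> {0<..<pi}")
      case True
      then have s: "sin \<theta> > 0" using sin_gt_zero by auto
      have "(\<integral>\<^sup>+v. indicator {0<..} v * indicator {0<..<pi} \<theta> * ennreal (v / (sin \<theta>)\<^sup>2) * G (v * cot \<theta>) v
          \<partial>lborel)
        = ennreal \<bar>sin \<theta>\<bar> * (\<integral>\<^sup>+r. indicator {0<..} (0 + sin \<theta> * r) * indicator {0<..<pi} \<theta>
            * ennreal ((0 + sin \<theta> * r) / (sin \<theta>)\<^sup>2) * G ((0 + sin \<theta> * r) * cot \<theta>) (0 + sin \<theta> * r) \<partial>lborel)"
        using s by (intro nn_integral_real_affine) auto
      also have "\<dots> = (\<integral>\<^sup>+r. ennreal \<bar>sin \<theta>\<bar> * (indicator {0<..} (0 + sin \<theta> * r) * indicator {0<..<pi} \<theta>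
          * ennreal ((0 + sin \<theta> * r) / (sin \<theta>)\<^sup>2) * G ((0 + sin \<theta> * r) * cot \<theta>) (0 + sin \<theta> * r)) \<partial>lborel)"
        by (subst nn_integral_cmult) auto
      also have "\<dots> = (\<integral>\<^sup>+r. indicator {0<..} r * indicator {0<..<pi} \<theta> * ennreal r
          * G (r * cos \<theta>) (r * sin \<theta>) \<partial>lborel)"
      proof (rule nn_integral_cong)
        fix r :: real
        show "ennreal \<bar>sin \<theta>\<bar> * (indicator {0<..} (0 + sin \<theta> * r) * indicator {0<..<pi} \<theta>
            * ennreal ((0 + sin \<theta> * r) / (sin \<theta>)\<^sup>2) * G ((0 + sin \<theta> * r) * cot \<theta>) (0 + sin \<theta> * r))
          = indicator {0<..} r * indicator {0<..<pi} \<theta> * ennreal r * G (r * cos \<theta>) (r * sin \<theta>)"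
        proof (cases "r > 0")
          case r: True
          have "r * sin \<theta> * cot \<theta> = r * cos \<theta>" using s by (simp add: cot_def)
          moreover have "ennreal \<bar>sin \<theta>\<bar> * ennreal ((sin \<theta> * r) / (sin \<theta>)\<^sup>2) = ennreal r"
            using s r by (subst ennreal_mult[symmetric]) (auto simp: power2_eq_square)
          moreover have "indicator {0<..} (sin \<theta> * r) = (1 :: ennreal)"
            using r s by simp
          ultimately show ?thesis using True r
            by (simp only: mult.assoc[symmetric] mult.commute[of "sin \<theta>" r] add_0) simp
        next
          case False
          then show ?thesis using s by (simp add: zero_less_mult_iff)
        qed
      qed
      finally show ?thesis by simp
    qed simp
  qed
  also have "\<dots> = (\<integral>\<^sup>+v. \<integral>\<^sup>+\<theta>. indicator {0<..} v * indicator {0<..<pi} \<theta> * ennreal (v / (sin \<theta>)\<^sup>2)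
      * G (v * cot \<theta>) v \<partial>lborel \<partial>lborel)"
    by (rule lborel_pair.Fubini'[symmetric]) measurable
  also have "\<dots> = (\<integral>\<^sup>+v. \<integral>\<^sup>+u. indicator {0<..} v * G u v \<partial>lborel \<partial>lborel)"
  proof (rule nn_integral_cong)
    fix v :: real
    show "(\<integral>\<^sup>+\<theta>. indicator {0<..} v * indicator {0<..<pi} \<theta> * ennreal (v / (sin \<theta>)\<^sup>2) * G (v * cot \<theta>) v \<partial>lborel)
      = (\<integral>\<^sup>+u. indicator {0<..} v * G u v \<partial>lborel)"
    proof (cases "v > 0")
      case True
      have "(\<integral>\<^sup>+u. indicator {0<..} v * G u v \<partial>lborel) = ennreal \<bar>v\<bar> *
          (\<integral>\<^sup>+w. indicator {0<..} v * G (0 + v * w) v \<partial>lborel)"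
        using True by (intro nn_integral_real_affine) auto
      also have "\<dots> = (\<integral>\<^sup>+w. ennreal v * G (v * w) v \<partial>lborel)"
        using True by (subst nn_integral_cmult) auto
      also have "\<dots> = (\<integral>\<^sup>+\<theta>. indicator {0<..<pi} \<theta> * ennreal (1 / (sin \<theta>)\<^sup>2) * (ennreal v * G (v * cot \<theta>) v)
          \<partial>lborel)"
        by (rule nn_integral_cot[symmetric]) measurable
      also have "\<dots> = (\<integral>\<^sup>+\<theta>. indicator {0<..} v * indicator {0<..<pi} \<theta> * ennreal (v / (sin \<theta>)\<^sup>2)
          * G (v * cot \<theta>) v \<partial>lborel)"
      proof (rule nn_integral_cong)
        fix \<theta> :: real
        have "ennreal (v / (sin \<theta>)\<^sup>2) = ennreal (1 / (sin \<theta>)\<^sup>2) * ennreal v"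
          using True by (subst ennreal_mult[symmetric]) auto
        then show "indicator {0<..<pi} \<theta> * ennreal (1 / (sin \<theta>)\<^sup>2) * (ennreal v * G (v * cot \<theta>) v)
          = indicator {0<..} v * indicator {0<..<pi} \<theta> * ennreal (v / (sin \<theta>)\<^sup>2) * G (v * cot \<theta>) v"
          using True by (simp add: mult.assoc)
      qed
      finally show ?thesis by simp
    qed simp
  qed
  finally show ?thesis .
qed

section \<open>The angular weight and translation of radial functions\<close>

text \<open>
  Euler's integral after the substitution \<open>t = r\<^sup>2\<close>: the radial and the Cartesian integrals of
  \<open>v powr 2\<alpha> * exp (- u\<^sup>2 - v\<^sup>2)\<close> are both of this form.
\<close>

lemma nn_integral_Gamma_square:
  assumes "s > 0"
  shows "(\<integral>\<^sup>+r. indicator {0<..} r * ennreal (r powr (2 * s - 1) * exp (- r\<^sup>2)) \<partial>lborel)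
      = ennreal (Gamma s / 2)"
proof -
  have bij: "bij_betw (\<lambda>r. r\<^sup>2) {0<..} {0::real<..}"
    by (rule bij_betw_byWitness[where f' = sqrt]) auto
  have "2 * (\<integral>\<^sup>+r. indicator {0<..} r * ennreal (r powr (2 * s - 1) * exp (- r\<^sup>2)) \<partial>lborel)
    = (\<integral>\<^sup>+r. 2 * (indicator {0<..} r * ennreal (r powr (2 * s - 1) * exp (- r\<^sup>2))) \<partial>lborel)"
    by (rule nn_integral_cmult[symmetric]) measurable
  also have "\<dots> = (\<integral>\<^sup>+r. indicator {0<..} r * ennreal \<bar>2 * r\<bar> * ennreal ((r\<^sup>2) powr (s - 1) * exp (- r\<^sup>2))
      \<partial>lborel)"
  proof (rule nn_integral_cong)
    fix r :: real
    show "2 * (indicator {0<..} r * ennreal (r powr (2 * s - 1) * exp (- r\<^sup>2)))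
      = indicator {0<..} r * ennreal \<bar>2 * r\<bar> * ennreal ((r\<^sup>2) powr (s - 1) * exp (- r\<^sup>2))"
    proof (cases "r > 0")
      case True
      have "(r\<^sup>2) powr (s - 1) = r powr (2 * (s - 1))"
        using True powr_powr[of r 2 "s - 1"] by simp
      moreover have "r powr (2 * s - 1) = r * r powr (2 * (s - 1))"
        using True powr_add[of r 1 "2 * (s - 1)"] by (simp add: algebra_simps)
      ultimately have "\<bar>2 * r\<bar> * ((r\<^sup>2) powr (s - 1) * exp (- r\<^sup>2)) = 2 * (r powr (2 * s - 1) * exp (- r\<^sup>2))"
        using True by simp
      then have "ennreal (\<bar>2 * r\<bar> * ((r\<^sup>2) powr (s - 1) * exp (- r\<^sup>2)))
          = ennreal (2 * (r powr (2 * s - 1) * exp (- r\<^sup>2)))"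
        by (simp only:)
      then have "ennreal \<bar>2 * r\<bar> * ennreal ((r\<^sup>2) powr (s - 1) * exp (- r\<^sup>2)) = 2
          * ennreal (r powr (2 * s - 1) * exp (- r\<^sup>2))"
        by (subst (asm) (1 2) ennreal_mult) simp_all
      with True show ?thesis by simp
    qed simp
  qed
  also have "\<dots> = (\<integral>\<^sup>+t. indicator {0<..} t * ennreal (t powr (s - 1) * exp (- t)) \<partial>lborel)"
    by (rule nn_integral_change_of_variables[OF _ _ _ _ _ _ bij]) (auto intro!: derivative_eq_intros)
  also have "\<dots> = (\<integral>\<^sup>+t. ennreal (indicator {0..} t * t powr (s - 1) / exp t) \<partial>lborel)"
    by (intro nn_integral_cong) (auto simp: exp_minus field_simps less_le split: split_indicator)
  also have "\<dots> = ennreal (Gamma s)"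
    using Gamma_conv_nn_integral_real[OF assms] by simp
  finally have "ennreal (1/2) * (2 * (\<integral>\<^sup>+r. indicator {0<..} r * ennreal (r powr (2 * s - 1) * exp (- r\<^sup>2))
      \<partial>lborel))
     = ennreal (1/2) * ennreal (Gamma s)" by simp
  moreover have "ennreal (1/2) * ennreal (Gamma s) = ennreal (Gamma s / 2)"
    using assms by (subst ennreal_mult[symmetric]) auto
  moreover have "ennreal (1/2) * 2 = 1"
  proof -
    have "ennreal (1/2) * ennreal 2 = ennreal 1" by (subst ennreal_mult[symmetric]) auto
    then show ?thesis by simp
  qed
  ultimately show ?thesis by (simp only: mult.assoc[symmetric]) simp
qed

lemma nn_integral_exp_neg_square: "(\<integral>\<^sup>+u. ennreal (exp (- u\<^sup>2)) \<partial>lborel) = ennreal (sqrt pi)"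
proof -
  have half: "(\<integral>\<^sup>+u. indicator {0<..} u * ennreal (exp (- u\<^sup>2)) \<partial>lborel) = ennreal (sqrt pi / 2)"
  proof -
    have "(\<integral>\<^sup>+u. indicator {0<..} u * ennreal (exp (- u\<^sup>2)) \<partial>lborel)
      = (\<integral>\<^sup>+u. indicator {0<..} u * ennreal (u powr (2 * (1/2) - 1) * exp (- u\<^sup>2)) \<partial>lborel)"
      by (intro nn_integral_cong) (auto split: split_indicator)
    also have "\<dots> = ennreal (sqrt pi / 2)"
      by (subst nn_integral_Gamma_square) (auto simp: Gamma_one_half_real)
    finally show ?thesis .
  qed
  have "(\<integral>\<^sup>+u. indicator {..<0} u * ennreal (exp (- u\<^sup>2)) \<partial>lborel) = ennreal \<bar>- 1\<bar> *
    (\<integral>\<^sup>+u. indicator {..<0} (0 + - 1 * u) * ennreal (exp (- (0 + - 1 * u)\<^sup>2)) \<partial>lborel)"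
    by (rule nn_integral_real_affine) auto
  also have "\<dots> = (\<integral>\<^sup>+u. indicator {0<..} u * ennreal (exp (- u\<^sup>2)) \<partial>lborel)"
    by (auto intro!: nn_integral_cong split: split_indicator)
  finally have neg: "(\<integral>\<^sup>+u. indicator {..<0} u * ennreal (exp (- u\<^sup>2)) \<partial>lborel) = ennreal (sqrt pi / 2)"
    using half by simp
  have "(\<integral>\<^sup>+u. ennreal (exp (- u\<^sup>2)) \<partial>lborel) =
    (\<integral>\<^sup>+u. indicator {0<..} u * ennreal (exp (- u\<^sup>2)) + indicator {..<0} u * ennreal (exp (- u\<^sup>2)) \<partial>lborel)"
    by (intro nn_integral_cong_AE eventually_mono[OF AE_lborel_singleton[of 0]]) (auto split: split_indicator)
  also have "\<dots> = ennreal (sqrt pi / 2) + ennreal (sqrt pi / 2)"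
    by (subst nn_integral_add) (simp_all only: half neg, measurable)
  also have "\<dots> = ennreal (sqrt pi)"
    by (subst ennreal_plus[symmetric]) auto
  finally show ?thesis .
qed

text \<open>
  Integrating \<open>v powr 2\<alpha> * exp (- u\<^sup>2 - v\<^sup>2)\<close> over the upper half-plane gives
  \<open>sqrt pi * Gamma (\<alpha> + 1/2) / 2\<close> in Cartesian coordinates, and the angular integral times
  \<open>Gamma (\<alpha> + 1) / 2\<close> in polar coordinates.
\<close>

lemma nn_integral_sin_powr:
  assumes "\<alpha> > - 1 / 2"
  shows "(\<integral>\<^sup>+\<theta>. indicator {0<..<pi} \<theta> * ennreal (sin \<theta> powr (2 * \<alpha>)) \<partial>lborel)
    = ennreal (sqrt pi * Gamma (\<alpha> + 1/2) / Gamma (\<alpha> + 1))" (is "?I = _")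
proof -
  have pos: "Gamma (\<alpha> + 1) > 0" "Gamma (\<alpha> + 1/2) > 0"
    using assms by (auto intro!: Gamma_real_pos)
  define G where "G = (\<lambda>u v :: real. ennreal (exp (- u\<^sup>2)) * ennreal (v powr (2 * \<alpha>) * exp (- v\<^sup>2)))"
  have [measurable]: "(\<lambda>(u, v). G u v) \<in> borel_measurable (borel \<Otimes>\<^sub>M borel)"
    unfolding G_def by measurable
  have "(\<integral>\<^sup>+v. \<integral>\<^sup>+u. indicator {0<..} v * G u v \<partial>lborel \<partial>lborel)
    = (\<integral>\<^sup>+v. (\<integral>\<^sup>+u. ennreal (exp (- u\<^sup>2)) * (indicator {0<..} v * ennreal (v powr (2 * \<alpha>) * exp (- v\<^sup>2)))
        \<partial>lborel) \<partial>lborel)"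
    unfolding G_def by (simp only: mult_ac)
  also have "\<dots> = (\<integral>\<^sup>+v. ennreal (sqrt pi) * (indicator {0<..} v
      * ennreal (v powr (2 * (\<alpha> + 1/2) - 1) * exp (- v\<^sup>2))) \<partial>lborel)"
    by (subst nn_integral_multc) (auto simp: nn_integral_exp_neg_square)
  also have "\<dots> = ennreal (sqrt pi) * ennreal (Gamma (\<alpha> + 1/2) / 2)"
    using assms by (subst nn_integral_cmult, measurable, subst nn_integral_Gamma_square) auto
  also have "\<dots> = ennreal (sqrt pi * Gamma (\<alpha> + 1/2) / 2)"
    by (subst ennreal_mult''[symmetric]) (use pos in auto)
  finally have 1: "(\<integral>\<^sup>+v. \<integral>\<^sup>+u. indicator {0<..} v * G u v \<partial>lborel \<partial>lborel)
      = ennreal (sqrt pi * Gamma (\<alpha> + 1/2) / 2)" .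
  have "(\<integral>\<^sup>+r. \<integral>\<^sup>+\<theta>. indicator {0<..} r * indicator {0<..<pi} \<theta> * ennreal r * G (r * cos \<theta>) (r * sin \<theta>)
      \<partial>lborel \<partial>lborel)
    = (\<integral>\<^sup>+r. \<integral>\<^sup>+\<theta>. (indicator {0<..<pi} \<theta> * ennreal (sin \<theta> powr (2 * \<alpha>)))
        * (indicator {0<..} r * ennreal (r powr (2 * (\<alpha> + 1) - 1) * exp (- r\<^sup>2))) \<partial>lborel \<partial>lborel)"
  proof (intro nn_integral_cong)
    fix r \<theta> :: real
    show "indicator {0<..} r * indicator {0<..<pi} \<theta> * ennreal r * G (r * cos \<theta>) (r * sin \<theta>) =
      (indicator {0<..<pi} \<theta> * ennreal (sin \<theta> powr (2 * \<alpha>)))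
          * (indicator {0<..} r * ennreal (r powr (2 * (\<alpha> + 1) - 1) * exp (- r\<^sup>2)))"
    proof (cases "r > 0 \<and> \<theta> \<in> {0<..<pi}")
      case True
      then have s: "sin \<theta> > 0" by (auto intro: sin_gt_zero)
      have "- ((r * cos \<theta>)\<^sup>2) + - ((r * sin \<theta>)\<^sup>2) = - (r\<^sup>2 * ((sin \<theta>)\<^sup>2 + (cos \<theta>)\<^sup>2))"
        by algebra
      then have "exp (- ((r * cos \<theta>)\<^sup>2)) * exp (- ((r * sin \<theta>)\<^sup>2)) = exp (- r\<^sup>2)"
        by (simp add: exp_add[symmetric])
      moreover have "r * (r * sin \<theta>) powr (2 * \<alpha>) = sin \<theta> powr (2 * \<alpha>) * r powr (2 * (\<alpha> + 1) - 1)"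
        using True s powr_add[of r 1 "2 * \<alpha>"] by (simp add: powr_mult algebra_simps)
      ultimately have "(r * (r * sin \<theta>) powr (2 * \<alpha>)) * (exp (- ((r * cos \<theta>)\<^sup>2)) * exp (- ((r * sin \<theta>)\<^sup>2)))
        = (sin \<theta> powr (2 * \<alpha>) * r powr (2 * (\<alpha> + 1) - 1)) * exp (- r\<^sup>2)"
        by (simp only:)
      then have "r * (exp (- ((r * cos \<theta>)\<^sup>2)) * ((r * sin \<theta>) powr (2 * \<alpha>) * exp (- ((r * sin \<theta>)\<^sup>2))))
        = sin \<theta> powr (2 * \<alpha>) * (r powr (2 * (\<alpha> + 1) - 1) * exp (- r\<^sup>2))"
        by (simp only: mult_ac)
      then show ?thesis unfolding G_def using True
        by (simp add: ennreal_mult[symmetric] del: ennreal_mult_eq_top_iff)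
    qed (auto split: split_indicator)
  qed
  also have "\<dots> = (\<integral>\<^sup>+r. ?I * (indicator {0<..} r * ennreal (r powr (2 * (\<alpha> + 1) - 1) * exp (- r\<^sup>2))) \<partial>lborel)"
    by (subst nn_integral_multc) auto
  also have "\<dots> = ?I * ennreal (Gamma (\<alpha> + 1) / 2)"
    using assms by (subst nn_integral_cmult, measurable, subst nn_integral_Gamma_square) auto
  finally have "?I * ennreal (Gamma (\<alpha> + 1) / 2) = ennreal (sqrt pi * Gamma (\<alpha> + 1/2) / 2)"
    using 1 nn_integral_polar_coordinates[of G] by simp
  then have "?I * ennreal (Gamma (\<alpha> + 1) / 2) * ennreal (2 / Gamma (\<alpha> + 1))
      = ennreal (sqrt pi * Gamma (\<alpha> + 1/2) / 2) * ennreal (2 / Gamma (\<alpha> + 1))"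
    by simp
  moreover have "ennreal (Gamma (\<alpha> + 1) / 2) * ennreal (2 / Gamma (\<alpha> + 1)) = 1"
    using pos by (subst ennreal_mult[symmetric]) auto
  moreover have "ennreal (sqrt pi * Gamma (\<alpha> + 1/2) / 2) * ennreal (2 / Gamma (\<alpha> + 1))
      = ennreal (sqrt pi * Gamma (\<alpha> + 1/2) / Gamma (\<alpha> + 1))"
    using pos by (subst ennreal_mult[symmetric]) auto
  ultimately show ?thesis by (simp only: mult.assoc) simp
qed

text \<open>
  In the half-plane with measure \<open>v powr 2\<alpha> du dv\<close> the left-hand side integrates the
  function \<open>h\<close> of the distance to \<open>(- x, 0)\<close>. A horizontal shift moves this point to the origin,
  where the integral in polar coordinates splits into an angular and a radial factor.
\<close>

lemma nn_integral_radial_translation: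
  fixes h :: "real \<Rightarrow> ennreal" and \<alpha> x :: real
  assumes [measurable]: "h \<in> borel_measurable borel"
  shows "(\<integral>\<^sup>+t. \<integral>\<^sup>+\<theta>. indicator {0<..} t * ennreal (t powr (2 * \<alpha> + 1))
      * (indicator {0<..<pi} \<theta> * ennreal (sin \<theta> powr (2 * \<alpha>))) *
            h (sqrt (x\<^sup>2 + t\<^sup>2 + 2 * x * t * cos \<theta>)) \<partial>lborel \<partial>lborel)
      = (\<integral>\<^sup>+\<theta>. indicator {0<..<pi} \<theta> * ennreal (sin \<theta> powr (2 * \<alpha>)) \<partial>lborel) *
        (\<integral>\<^sup>+t. indicator {0<..} t * ennreal (t powr (2 * \<alpha> + 1)) * h t \<partial>lborel)"
proof -
  define L where "L = (\<lambda>x. \<integral>\<^sup>+t. \<integral>\<^sup>+\<theta>. indicator {0<..} t * ennreal (t powr (2 * \<alpha> + 1))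
      * (indicator {0<..<pi} \<theta> * ennreal (sin \<theta> powr (2 * \<alpha>))) *
            h (sqrt (x\<^sup>2 + t\<^sup>2 + 2 * x * t * cos \<theta>)) \<partial>lborel \<partial>lborel)"
  \<comment> \<open>The law of cosines: \<open>(t cos \<theta> + x)\<^sup>2 + (t sin \<theta>)\<^sup>2 = x\<^sup>2 + t\<^sup>2 + 2 x t cos \<theta>\<close>.\<close>
  have cart: "L x = (\<integral>\<^sup>+v. \<integral>\<^sup>+u. indicator {0<..} v
      * (ennreal (v powr (2 * \<alpha>)) * h (sqrt ((u + x)\<^sup>2 + v\<^sup>2))) \<partial>lborel \<partial>lborel)" for x
  proof -
    have "L x = (\<integral>\<^sup>+r. \<integral>\<^sup>+\<theta>. indicator {0<..} r * indicator {0<..<pi} \<theta> * ennreal r *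
        (ennreal ((r * sin \<theta>) powr (2 * \<alpha>)) * h (sqrt ((r * cos \<theta> + x)\<^sup>2 + (r * sin \<theta>)\<^sup>2))) \<partial>lborel \<partial>lborel)"
      unfolding L_def
    proof (intro nn_integral_cong)
      fix t \<theta> :: real
      show "indicator {0<..} t * ennreal (t powr (2 * \<alpha> + 1))
          * (indicator {0<..<pi} \<theta> * ennreal (sin \<theta> powr (2 * \<alpha>))) *
            h (sqrt (x\<^sup>2 + t\<^sup>2 + 2 * x * t * cos \<theta>)) = indicator {0<..} t * indicator {0<..<pi} \<theta> * ennreal t *
        (ennreal ((t * sin \<theta>) powr (2 * \<alpha>)) * h (sqrt ((t * cos \<theta> + x)\<^sup>2 + (t * sin \<theta>)\<^sup>2)))"
      proof (cases "t > 0 \<and> \<theta> \<in> {0<..<pi}")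
        case True
        then have s: "sin \<theta> > 0" by (auto intro: sin_gt_zero)
        have "(t * cos \<theta> + x)\<^sup>2 + (t * sin \<theta>)\<^sup>2 = x\<^sup>2 + t\<^sup>2 * ((sin \<theta>)\<^sup>2 + (cos \<theta>)\<^sup>2) + 2 * x * t * cos \<theta>"
          by algebra
        then have "(t * cos \<theta> + x)\<^sup>2 + (t * sin \<theta>)\<^sup>2 = x\<^sup>2 + t\<^sup>2 + 2 * x * t * cos \<theta>" by simp
        moreover have "t powr (2 * \<alpha> + 1) * sin \<theta> powr (2 * \<alpha>) = t * (t * sin \<theta>) powr (2 * \<alpha>)"
          using True s powr_add[of t 1 "2 * \<alpha>"] by (simp add: powr_mult algebra_simps)
        then have "ennreal (t powr (2 * \<alpha> + 1)) * ennreal (sin \<theta> powr (2 * \<alpha>)) = ennreal t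
            * ennreal ((t * sin \<theta>) powr (2 * \<alpha>))"
          using True by (simp add: ennreal_mult[symmetric])
        ultimately show ?thesis using True by (simp add: mult.assoc[symmetric])
      qed (auto split: split_indicator)
    qed
    also have "\<dots> = (\<integral>\<^sup>+v. \<integral>\<^sup>+u. indicator {0<..} v * (ennreal (v powr (2 * \<alpha>)) * h (sqrt ((u + x)\<^sup>2 + v\<^sup>2)))
        \<partial>lborel \<partial>lborel)"
      by (rule nn_integral_polar_coordinates) measurable
    finally show ?thesis .
  qed
  have "L x = L 0"
    unfolding cart
  proof (rule nn_integral_cong)
    fix v :: real
    have "(\<integral>\<^sup>+u. indicator {0<..} v * (ennreal (v powr (2 * \<alpha>)) * h (sqrt ((u + 0)\<^sup>2 + v\<^sup>2))) \<partial>lborel)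
      = ennreal \<bar>1\<bar> * (\<integral>\<^sup>+u. indicator {0<..} v
          * (ennreal (v powr (2 * \<alpha>)) * h (sqrt ((x + 1 * u + 0)\<^sup>2 + v\<^sup>2))) \<partial>lborel)"
      by (rule nn_integral_real_affine) auto
    then show "(\<integral>\<^sup>+u. indicator {0<..} v * (ennreal (v powr (2 * \<alpha>)) * h (sqrt ((u + x)\<^sup>2 + v\<^sup>2))) \<partial>lborel)
      = (\<integral>\<^sup>+u. indicator {0<..} v * (ennreal (v powr (2 * \<alpha>)) * h (sqrt ((u + 0)\<^sup>2 + v\<^sup>2))) \<partial>lborel)"
      by (simp add: add.commute)
  qed
  also have "L 0 = (\<integral>\<^sup>+t. \<integral>\<^sup>+\<theta>. (indicator {0<..<pi} \<theta> * ennreal (sin \<theta> powr (2 * \<alpha>)))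
      * (indicator {0<..} t * ennreal (t powr (2 * \<alpha> + 1)) * h t) \<partial>lborel \<partial>lborel)"
    unfolding L_def by (intro nn_integral_cong) (auto simp: mult_ac split: split_indicator)
  also have "\<dots> = (\<integral>\<^sup>+\<theta>. indicator {0<..<pi} \<theta> * ennreal (sin \<theta> powr (2 * \<alpha>)) \<partial>lborel) *
        (\<integral>\<^sup>+t. indicator {0<..} t * ennreal (t powr (2 * \<alpha> + 1)) * h t \<partial>lborel)"
    by (simp add: nn_integral_multc nn_integral_cmult)
  finally show ?thesis unfolding L_def .
qed

section \<open>Estimates in Lebesgue spaces\<close>

text \<open>
  Bounds by a real number are the working form of the norm below: they avoid roots of integrals that
  might be infinite, and for \<open>p = \<infinity>\<close> they become the almost everywhere bound of the next lemma.
\<close>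

lemma Lp_norm_le_iff_finite:
  assumes [measurable]: "f \<in> borel_measurable M" and "p \<noteq> \<infinity>" "1 \<le> p" "0 \<le> B"
  shows "Lp_norm M p f \<le> ennreal B \<longleftrightarrow>
    (\<integral>\<^sup>+x. ennreal (norm (f x) powr enn2real p) \<partial>M) \<le> ennreal (B powr enn2real p)"
proof -
  define r where "r = enn2real p"
  have "r > 0" using assms(2,3) unfolding r_def
    by (metis enn2real_positive_iff infinity_ennreal_def not_one_le_zero top.not_eq_extremum
        zero_less_iff_neq_zero)
  define I where "I = (\<integral>\<^sup>+x. ennreal (norm (f x) powr r) \<partial>M)"
  have N: "Lp_norm M p f = (if I = \<infinity> then \<infinity> else ennreal (enn2real I powr (1 / r)))"
    using assms(2) by (simp add: Lp_norm_def I_def r_def)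
  have "Lp_norm M p f \<le> ennreal B \<longleftrightarrow> I \<le> ennreal (B powr r)"
  proof (cases I)
    case (real i)
    have "i powr (1 / r) \<le> B \<longleftrightarrow> i \<le> B powr r"
    proof
      assume "i powr (1 / r) \<le> B"
      then have "(i powr (1 / r)) powr r \<le> B powr r" using \<open>r > 0\<close> by (intro powr_mono2) auto
      then show "i \<le> B powr r" using \<open>r > 0\<close> real by (simp add: powr_powr)
    next
      assume "i \<le> B powr r"
      then have "i powr (1 / r) \<le> (B powr r) powr (1 / r)" using \<open>r > 0\<close> real by (intro powr_mono2) auto
      then show "i powr (1 / r) \<le> B" using \<open>r > 0\<close> \<open>0 \<le> B\<close> by (simp add: powr_powr)
    qed
    then show ?thesis using real \<open>0 \<le> B\<close> by (simp add: N)
  next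
    case top
    then show ?thesis by (simp add: N top_unique)
  qed
  then show ?thesis by (simp add: I_def r_def)
qed

lemma Lp_norm_le_iff_infinity:
  assumes [measurable]: "f \<in> borel_measurable M" and "0 \<le> B"
  shows "Lp_norm M top f \<le> ennreal B \<longleftrightarrow> (AE x in M. norm (f x) \<le> B)"
proof
  assume *: "Lp_norm M top f \<le> ennreal B"
  have "AE x in M. ennreal (norm (f x)) \<le> esssup M (\<lambda>x. ennreal (norm (f x)))"
    by (rule esssup_AE)
  then show "AE x in M. norm (f x) \<le> B"
  proof (rule eventually_mono)
    fix x assume "ennreal (norm (f x)) \<le> esssup M (\<lambda>x. ennreal (norm (f x)))"
    also have "\<dots> \<le> ennreal B" using * by (simp add: Lp_norm_def)
    finally show "norm (f x) \<le> B" using \<open>0 \<le> B\<close> by simp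
  qed
next
  assume "AE x in M. norm (f x) \<le> B"
  then have "AE x in M. ennreal (norm (f x)) \<le> ennreal B"
    by (rule eventually_mono) (simp add: ennreal_leI)
  then show "Lp_norm M top f \<le> ennreal B"
    unfolding Lp_norm_def by (auto intro!: esssup_I)
qed

lemma Lp_norm_1:
  "Lp_norm M 1 f = (\<integral>\<^sup>+x. ennreal (norm (f x)) \<partial>M)"
  by (cases "\<integral>\<^sup>+x. ennreal (norm (f x)) \<partial>M") (simp_all add: Lp_norm_def)

lemma Lp_norm_cong:
  assumes "\<And>x. x \<in> space M \<Longrightarrow> f x = g x"
  shows "Lp_norm M p f = Lp_norm M p g"
proof -
  have "(\<lambda>x. ennreal (norm (f x))) \<in> borel_measurable M \<longleftrightarrow> (\<lambda>x. ennreal (norm (g x))) \<in> borel_measurable M"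
    using assms by (intro measurable_cong) simp
  moreover have "Limsup (ae_filter M) (\<lambda>x. ennreal (norm (f x)))
      = Limsup (ae_filter M) (\<lambda>x. ennreal (norm (g x)))"
    using assms by (intro Limsup_eq AE_I2) simp
  ultimately have "esssup M (\<lambda>x. ennreal (norm (f x))) = esssup M (\<lambda>x. ennreal (norm (g x)))"
    by (simp add: esssup_def)
  moreover have "(\<integral>\<^sup>+x. ennreal (norm (f x) powr enn2real p) \<partial>M) =
      (\<integral>\<^sup>+x. ennreal (norm (g x) powr enn2real p) \<partial>M)"
    using assms by (intro nn_integral_cong) simp
  ultimately show ?thesis by (simp add: Lp_norm_def)
qed

text \<open>
  The relation is stated with real reciprocals, so that exponents occurring in powers can be added.
  Since \<open>enn2real \<infinity> = 0\<close> and \<open>1 / 0 = 0\<close>, the term \<open>1 / enn2real p\<close> has the intended value \<open>0\<close> at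
  \<open>p = \<infinity>\<close>; the bounds \<open>1 \<le> p\<close> and \<open>1 \<le> q\<close> exclude the exponent \<open>0\<close>, which would have the same
  real reciprocal.
\<close>

definition conjugate_exponents :: "ennreal \<Rightarrow> ennreal \<Rightarrow> bool" where
  "conjugate_exponents p q \<longleftrightarrow> 1 \<le> p \<and> 1 \<le> q \<and> 1 / enn2real p + 1 / enn2real q = 1"

lemma conjugate_exponents_cases:
  assumes "conjugate_exponents p q"
  obtains (one) "p = 1" "q = \<infinity>" | (top) "p = \<infinity>" "q = 1"
    | (finite) "p \<noteq> \<infinity>" "q \<noteq> \<infinity>" "1 < enn2real p" "1 < enn2real q"
proof -
  have pq: "1 \<le> p" "1 \<le> q" "1 / enn2real p + 1 / enn2real q = 1"
    using assms by (auto simp: conjugate_exponents_def)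
  have ge: "1 \<le> enn2real t" if "1 \<le> t" "t \<noteq> \<infinity>" for t
    using that by (cases t) auto
  show ?thesis
  proof (cases "p = \<infinity> \<or> q = \<infinity>")
    case True
    then show ?thesis
    proof
      assume "p = \<infinity>"
      then have "enn2real q = 1" using pq(3) by (auto simp: field_simps split: if_splits)
      then have "q = 1" by (cases q) auto
      with \<open>p = \<infinity>\<close> show ?thesis by (rule top)
    next
      assume "q = \<infinity>"
      then have "enn2real p = 1" using pq(3) by (auto simp: field_simps split: if_splits)
      then have "p = 1" by (cases p) auto
      then show ?thesis using \<open>q = \<infinity>\<close> by (rule one)
    qed
  next
    case False
    then have "1 \<le> enn2real p" "1 \<le> enn2real q" using ge pq by auto
    moreover from this have "1 / enn2real p > 0" "1 / enn2real q > 0" by auto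
    then have "1 / enn2real p < 1" "1 / enn2real q < 1" using pq(3) by linarith+
    ultimately show ?thesis using False finite by (auto simp: field_simps)
  qed
qed

lemma conjugate_exponentsI:
  assumes "1 \<le> p" "1 / p + 1 / q = 1"
  shows "conjugate_exponents p q"
proof -
  have "q \<noteq> 0" using assms(2) by auto
  have le: "1 / q \<le> 1" using assms(2) by (metis add.commute le_iff_add)
  have "1 \<le> q"
  proof (cases q)
    case (real t)
    with \<open>q \<noteq> 0\<close> have "t > 0" by auto
    moreover have "ennreal (1 / t) \<le> 1"
      using le real divide_ennreal[of 1 t] \<open>t > 0\<close> by simp
    ultimately show ?thesis using real by (simp add: field_simps flip: ennreal_1)
  qed simp
  have inv: "1 / t = ennreal (1 / enn2real t)" if "1 \<le> t" for t :: ennreal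
  proof (cases t)
    case (real x)
    with that have "x \<ge> 1" by (simp flip: ennreal_1)
    with real show ?thesis using divide_ennreal[of 1 x] by simp
  qed simp
  have "ennreal (1 / enn2real p + 1 / enn2real q) = 1"
    using assms(2) inv[OF \<open>1 \<le> p\<close>] inv[OF \<open>1 \<le> q\<close>] by (simp add: ennreal_plus)
  then have "1 / enn2real p + 1 / enn2real q = 1" by (simp del: ennreal_plus)
  then show ?thesis using \<open>1 \<le> p\<close> \<open>1 \<le> q\<close> by (simp add: conjugate_exponents_def)
qed

lemma ex_conjugate_exponent:
  assumes "1 \<le> p" obtains q where "conjugate_exponents p q"
proof (cases p)
  case (real r)
  with assms have "r \<ge> 1" by (simp flip: ennreal_1)
  show ?thesis
  proof (cases "r = 1")
    case True
    then have "conjugate_exponents p \<infinity>" using real by (simp add: conjugate_exponents_def)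
    then show ?thesis by (rule that)
  next
    case False
    then have "conjugate_exponents p (ennreal (r / (r - 1)))"
      using real \<open>r \<ge> 1\<close> by (auto simp: conjugate_exponents_def field_simps simp flip: ennreal_1)
    then show ?thesis by (rule that)
  qed
next
  case top
  then have "conjugate_exponents p 1" by (simp add: conjugate_exponents_def)
  then show ?thesis by (rule that)
qed

text \<open>
  For finite exponents this is Young's inequality for \<open>|f| / A\<close> and \<open>|g| / B\<close>, integrated; if \<open>A\<close> or \<open>B\<close>
  vanishes, so does the product almost everywhere.
\<close>

lemma Hoelder_inequality:
  fixes f g :: "'a \<Rightarrow> complex"
  assumes pq: "conjugate_exponents p q"
    and [measurable]: "f \<in> borel_measurable M" "g \<in> borel_measurable M"
    and f: "Lp_norm M p f \<le> ennreal A" "0 \<le> A" and g: "Lp_norm M q g \<le> ennreal B" "0 \<le> B"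
  shows "(\<integral>\<^sup>+x. ennreal (norm (f x * g x)) \<partial>M) \<le> ennreal (A * B)"
proof -
  have one_infty: "(\<integral>\<^sup>+x. ennreal (norm (h x * k x)) \<partial>M) \<le> ennreal (C * D)"
    if h: "Lp_norm M 1 h \<le> ennreal C" "0 \<le> C" and k: "Lp_norm M \<infinity> k \<le> ennreal D" "0 \<le> D"
      and [measurable]: "h \<in> borel_measurable M" "k \<in> borel_measurable M"
    for h k :: "'a \<Rightarrow> complex" and C D
  proof -
    have "AE x in M. norm (k x) \<le> D" using k by (simp add: Lp_norm_le_iff_infinity)
    then have "AE x in M. ennreal (norm (h x * k x)) \<le> ennreal (norm (h x)) * ennreal D"
    proof (rule eventually_mono)
      fix x assume "norm (k x) \<le> D"
      then show "ennreal (norm (h x * k x)) \<le> ennreal (norm (h x)) * ennreal D"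
        by (simp add: norm_mult ennreal_mult[symmetric] k(2) ennreal_leI mult_left_mono)
    qed
    then have "(\<integral>\<^sup>+x. ennreal (norm (h x * k x)) \<partial>M) \<le> (\<integral>\<^sup>+x. ennreal (norm (h x)) * ennreal D \<partial>M)"
      by (rule nn_integral_mono_AE)
    also have "\<dots> = Lp_norm M 1 h * ennreal D"
      unfolding Lp_norm_1 by (rule nn_integral_multc) measurable
    also have "\<dots> \<le> ennreal C * ennreal D" using h by (intro mult_right_mono) auto
    also have "\<dots> = ennreal (C * D)" using h k by (simp add: ennreal_mult)
    finally show ?thesis .
  qed
  from pq show ?thesis
  proof (cases rule: conjugate_exponents_cases)
    case one
    then show ?thesis using one_infty[of f A g B] f g by simp
  next
    case top
    then show ?thesis using one_infty[of g B f A] f g by (simp add: mult.commute)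
  next
    case finite
    define r s where "r = enn2real p" and "s = enn2real q"
    have rs: "r > 1" "s > 1" "1 / r + 1 / s = 1"
      using finite pq by (auto simp: r_def s_def conjugate_exponents_def)
    have If: "(\<integral>\<^sup>+x. ennreal (norm (f x) powr r) \<partial>M) \<le> ennreal (A powr r)"
      using f finite pq by (subst (asm) Lp_norm_le_iff_finite) (auto simp: r_def conjugate_exponents_def)
    have Ig: "(\<integral>\<^sup>+x. ennreal (norm (g x) powr s) \<partial>M) \<le> ennreal (B powr s)"
      using g finite pq by (subst (asm) Lp_norm_le_iff_finite) (auto simp: s_def conjugate_exponents_def)
    show ?thesis
    proof (cases "A = 0 \<or> B = 0")
      case True
      have "AE x in M. f x = 0 \<or> g x = 0"
      proof (cases "A = 0")
        case True
        then have "(\<integral>\<^sup>+x. ennreal (norm (f x) powr r) \<partial>M) = 0" using If by simp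
        then have "AE x in M. ennreal (norm (f x) powr r) = 0"
          by (subst (asm) nn_integral_0_iff_AE) auto
        then show ?thesis by (rule eventually_mono) (simp add: ennreal_eq_0_iff)
      next
        case False
        then have "B = 0" using True by simp
        then have "(\<integral>\<^sup>+x. ennreal (norm (g x) powr s) \<partial>M) = 0" using Ig by simp
        then have "AE x in M. ennreal (norm (g x) powr s) = 0"
          by (subst (asm) nn_integral_0_iff_AE) auto
        then show ?thesis by (rule eventually_mono) (simp add: ennreal_eq_0_iff)
      qed
      then have "(\<integral>\<^sup>+x. ennreal (norm (f x * g x)) \<partial>M) = (\<integral>\<^sup>+x. 0 \<partial>M)"
        by (intro nn_integral_cong_AE) auto
      then show ?thesis by simp
    next
      case False
      then have AB: "A > 0" "B > 0" using f g by auto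
      \<comment> \<open>The weights of Young's inequality for \<open>|f| / A\<close> and \<open>|g| / B\<close>, multiplied by \<open>A * B\<close>.\<close>
      define a b where "a = A * B / (r * A powr r)" and "b = A * B / (s * B powr s)"
      have ab: "a \<ge> 0" "b \<ge> 0" using AB rs by (auto simp: a_def b_def)
      have young: "norm (f x * g x) \<le> a * norm (f x) powr r + b * norm (g x) powr s" for x
      proof -
        have "(norm (f x) / A) * (norm (g x) / B) \<le> (norm (f x) / A) powr r / r + (norm (g x) / B) powr s / s"
          using AB rs by (intro Youngs_inequality) auto
        then have "(A * B) * ((norm (f x) / A) * (norm (g x) / B)) \<le> (A * B)
            * ((norm (f x) / A) powr r / r + (norm (g x) / B) powr s / s)"
          using AB by (intro mult_left_mono) auto
        then show ?thesis using AB
          by (simp add: a_def b_def norm_mult powr_divide field_simps)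
      qed
      have "(\<integral>\<^sup>+x. ennreal (norm (f x * g x)) \<partial>M)
        \<le> (\<integral>\<^sup>+x. ennreal a * ennreal (norm (f x) powr r) + ennreal b * ennreal (norm (g x) powr s) \<partial>M)"
        using young ab by (intro nn_integral_mono)
            (simp add: ennreal_mult[symmetric] ennreal_plus[symmetric] ennreal_leI del: ennreal_plus)
      also have "\<dots> = ennreal a * (\<integral>\<^sup>+x. ennreal (norm (f x) powr r) \<partial>M) + ennreal b *
          (\<integral>\<^sup>+x. ennreal (norm (g x) powr s) \<partial>M)"
        by (simp add: nn_integral_add nn_integral_cmult)
      also have "\<dots> \<le> ennreal a * ennreal (A powr r) + ennreal b * ennreal (B powr s)"
        using If Ig by (intro add_mono mult_left_mono) auto
      also have "\<dots> = ennreal (a * A powr r + b * B powr s)"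
        using ab by (simp add: ennreal_mult[symmetric] ennreal_plus[symmetric] del: ennreal_plus)
      also have "a * A powr r + b * B powr s = A * B * (1 / r + 1 / s)"
        using AB rs(1,2) by (simp add: a_def b_def distrib_left)
      finally show ?thesis using rs(3) by simp
    qed
  qed
qed

text \<open>
  For \<open>S = 0\<close> and \<open>q = \<infinity>\<close> the bound reads \<open>0 powr 0 = 0\<close>, which is right for a null measure; so a
  symbol that vanishes almost everywhere is covered by the same formulas as any other.
\<close>

lemma Lp_norm_const_le:
  assumes "1 \<le> q" and S: "emeasure M (space M) = ennreal S" "0 \<le> S"
  shows "Lp_norm M q (\<lambda>_. 1) \<le> ennreal (S powr (1 / enn2real q))"
proof (cases "q = \<infinity>")
  case True
  have "AE x in M. norm (1 :: complex) \<le> S powr 0"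
  proof (cases "S = 0")
    case True
    then have "AE x in M. False" using S by (intro AE_I[of _ _ "space M"]) auto
    then show ?thesis by (rule eventually_mono) simp
  qed simp
  then show ?thesis
    using True Lp_norm_le_iff_infinity[of "\<lambda>_. 1" M "S powr 0"] by simp
next
  case False
  then have "enn2real q \<ge> 1" using assms(1) by (cases q) auto
  then show ?thesis using False assms S
    by (subst Lp_norm_le_iff_finite) (auto simp: powr_powr)
qed

lemma Lp_norm_cmult_le:
  assumes [measurable]: "f \<in> borel_measurable M" and "1 \<le> p" and f: "Lp_norm M p f \<le> ennreal B" "0 \<le> B"
  shows "Lp_norm M p (\<lambda>x. c * f x) \<le> ennreal (norm c * B)"
proof (cases "p = \<infinity>")
  case True
  have "AE x in M. norm (f x) \<le> B" using f True by (simp add: Lp_norm_le_iff_infinity)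
  then have "AE x in M. norm (c * f x) \<le> norm c * B"
    by (rule eventually_mono) (simp add: norm_mult mult_left_mono)
  then show ?thesis using True f by (simp add: Lp_norm_le_iff_infinity)
next
  case False
  define r where "r = enn2real p"
  have If: "(\<integral>\<^sup>+x. ennreal (norm (f x) powr r) \<partial>M) \<le> ennreal (B powr r)"
    using f False assms by (subst (asm) Lp_norm_le_iff_finite) (auto simp: r_def)
  have "(\<integral>\<^sup>+x. ennreal (norm (c * f x) powr r) \<partial>M) =
      (\<integral>\<^sup>+x. ennreal (norm c powr r) * ennreal (norm (f x) powr r) \<partial>M)"
    by (simp add: norm_mult powr_mult ennreal_mult)
  also have "\<dots> = ennreal (norm c powr r) * (\<integral>\<^sup>+x. ennreal (norm (f x) powr r) \<partial>M)"
    by (rule nn_integral_cmult) measurable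
  also have "\<dots> \<le> ennreal (norm c powr r) * ennreal (B powr r)"
    using If by (intro mult_left_mono) auto
  also have "\<dots> = ennreal ((norm c * B) powr r)" using f by (simp add: powr_mult ennreal_mult)
  finally show ?thesis using False assms f
    by (subst Lp_norm_le_iff_finite) (auto simp: r_def)
qed

text \<open>
  Used in two cases: a dilation, which scales the measure by \<open>c\<close>, and the map
  \<open>(\<theta>, y) \<mapsto> translated point\<close>, which preserves it (\<open>c = 1\<close>). For \<open>p = \<infinity>\<close> what matters is that
  preimages of null sets are null.
\<close>

lemma Lp_norm_pullback_le:
  assumes [measurable]: "s \<in> M' \<rightarrow>\<^sub>M M" "f \<in> borel_measurable M" and "1 \<le> p" "0 < c"
    and s: "\<And>g. g \<in> borel_measurable M \<Longrightarrow> (\<integral>\<^sup>+x. g (s x) \<partial>M') = ennreal c * (\<integral>\<^sup>+x. g x \<partial>M)"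
    and f: "Lp_norm M p f \<le> ennreal B" "0 \<le> B"
  shows "Lp_norm M' p (\<lambda>x. f (s x)) \<le> ennreal (c powr (1 / enn2real p) * B)"
proof (cases "p = \<infinity>")
  case True
  have "AE x in M. norm (f x) \<le> B" using f True by (simp add: Lp_norm_le_iff_infinity)
  then have "(\<integral>\<^sup>+x. indicator {x \<in> space M. \<not> norm (f x) \<le> B} x \<partial>M) = 0"
    by (subst nn_integral_0_iff_AE) auto
  then have "(\<integral>\<^sup>+x. indicator {x \<in> space M. \<not> norm (f x) \<le> B} (s x) \<partial>M') = 0"
    by (subst s) auto
  then have "AE x in M'. indicator {x \<in> space M. \<not> norm (f x) \<le> B} (s x) = (0 :: ennreal)"
    by (subst (asm) nn_integral_0_iff_AE) auto
  moreover have "AE x in M'. s x \<in> space M" by (auto intro: measurable_space[OF assms(1)])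
  ultimately have "AE x in M'. norm (f (s x)) \<le> B"
    by eventually_elim (auto split: split_indicator_asm)
  then show ?thesis using True f \<open>0 < c\<close> by (simp add: Lp_norm_le_iff_infinity)
next
  case False
  define r where "r = enn2real p"
  have "r \<ge> 1" using assms(3) False unfolding r_def by (cases p) auto
  have If: "(\<integral>\<^sup>+x. ennreal (norm (f x) powr r) \<partial>M) \<le> ennreal (B powr r)"
    using f False assms(3) by (subst (asm) Lp_norm_le_iff_finite) (auto simp: r_def)
  have "(\<integral>\<^sup>+x. ennreal (norm (f (s x)) powr r) \<partial>M') = ennreal c * (\<integral>\<^sup>+x. ennreal (norm (f x) powr r) \<partial>M)"
    by (rule s) measurable
  also have "\<dots> \<le> ennreal c * ennreal (B powr r)"
    using If by (intro mult_left_mono) auto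
  also have "\<dots> = ennreal ((c powr (1 / r) * B) powr r)"
    using f \<open>0 < c\<close> \<open>r \<ge> 1\<close> by (simp add: powr_mult powr_powr ennreal_mult)
  finally show ?thesis using False assms(3) f
    by (subst Lp_norm_le_iff_finite) (auto simp: r_def)
qed

lemma Lp_norm_fibrewise_le:
  fixes h :: "'z \<Rightarrow> 'a \<Rightarrow> complex"
  assumes "sigma_finite_measure M" "1 \<le> p" and S: "emeasure N (space N) = ennreal S" "0 \<le> S"
    and [measurable]: "case_prod h \<in> borel_measurable (N \<Otimes>\<^sub>M M)"
    and h: "\<And>z. z \<in> space N \<Longrightarrow> Lp_norm M p (h z) \<le> ennreal B" "0 \<le> B"
  shows "Lp_norm (N \<Otimes>\<^sub>M M) p (case_prod h) \<le> ennreal (S powr (1 / enn2real p) * B)"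
proof -
  interpret sigma_finite_measure M by fact
  interpret N: finite_measure N by (rule finite_measureI) (use S in simp)
  interpret pair_sigma_finite N M ..
  have hz: "h z \<in> borel_measurable M" if "z \<in> space N" for z
    using measurable_Pair2[OF assms(5) that] by simp
  show ?thesis
  proof (cases "p = \<infinity>")
    case True
    have "AE z in N. AE y in M. norm (h z y) \<le> S powr 0 * B"
    proof (cases "S = 0")
      case True
      then have "AE x in N. False" using S by (intro AE_I[of _ _ "space N"]) auto
      then show ?thesis by (rule eventually_mono) simp
    next
      case False
      show ?thesis
        by (rule AE_I2) (use h hz \<open>p = \<infinity>\<close> False in \<open>simp add: Lp_norm_le_iff_infinity\<close>)
    qed
    then have "AE w in N \<Otimes>\<^sub>M M. norm (case_prod h w) \<le> S powr 0 * B"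
      by (intro AE_pair_measure) auto
    then show ?thesis using True h by (simp add: Lp_norm_le_iff_infinity)
  next
    case False
    define r where "r = enn2real p"
    have "r \<ge> 1" using assms(2) False unfolding r_def by (cases p) auto
    have "(\<integral>\<^sup>+w. ennreal (norm (case_prod h w) powr r) \<partial>(N \<Otimes>\<^sub>M M)) =
        (\<integral>\<^sup>+z. \<integral>\<^sup>+y. ennreal (norm (h z y) powr r) \<partial>M \<partial>N)"
      using sigma_finite_measure.nn_integral_fst[OF assms(1), of "\<lambda>(z, y). ennreal (norm (h z y) powr r)" N]
      by (simp add: case_prod_beta')
    also have "\<dots> \<le> (\<integral>\<^sup>+z. ennreal (B powr r) \<partial>N)"
    proof (rule nn_integral_mono)
      fix z assume z: "z \<in> space N"
      show "(\<integral>\<^sup>+y. ennreal (norm (h z y) powr r) \<partial>M) \<le> ennreal (B powr r)"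
        using h(1)[OF z] hz[OF z] False assms(2) h(2) by (subst (asm) Lp_norm_le_iff_finite) (auto simp: r_def)
    qed
    also have "\<dots> = ennreal ((S powr (1 / r) * B) powr r)"
      using S h \<open>r \<ge> 1\<close> by (simp add: powr_mult powr_powr ennreal_mult mult.commute)
    finally show ?thesis using False assms(2) h
      by (subst Lp_norm_le_iff_finite) (auto simp: r_def)
  qed
qed

text \<open>
  The Hoelder inequality on \<open>N\<close> against the constant \<open>1\<close> bounds the inner integral at \<open>y\<close> by the \<open>L\<^sup>p\<close>
  norm of the fibre \<open>h _ y\<close> times a power of the mass \<open>S\<close>; integrating the \<open>p\<close>-th power over \<open>y\<close>
  reassembles the norm of \<open>h\<close> on the product space. This replaces Minkowski's integral inequality,
  and also yields convergence of the inner integral for almost every \<open>y\<close>.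
\<close>

lemma Lp_norm_integral_le:
  fixes h :: "'z \<Rightarrow> 'a \<Rightarrow> complex"
  assumes "sigma_finite_measure M" "1 \<le> p" and S: "emeasure N (space N) = ennreal S" "0 \<le> S"
    and [measurable]: "case_prod h \<in> borel_measurable (N \<Otimes>\<^sub>M M)"
    and h: "Lp_norm (N \<Otimes>\<^sub>M M) p (case_prod h) \<le> ennreal C" "0 \<le> C"
  shows "AE y in M. integrable N (\<lambda>z. h z y)"
    and "Lp_norm M p (\<lambda>y. \<integral>z. h z y \<partial>N) \<le> ennreal (S powr (1 - 1 / enn2real p) * C)"
proof -
  interpret sigma_finite_measure M by fact
  interpret N: finite_measure N by (rule finite_measureI) (use S in simp)
  interpret pair_sigma_finite N M ..
  obtain q where pq: "conjugate_exponents p q" using ex_conjugate_exponent[OF \<open>1 \<le> p\<close>] .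
  then have q: "1 \<le> q" and s: "1 / enn2real q = 1 - 1 / enn2real p" by (auto simp: conjugate_exponents_def)
  have m[measurable]: "(\<lambda>(y, z). h z y) \<in> borel_measurable (M \<Otimes>\<^sub>M N)"
    using measurable_compose[OF measurable_pair_swap' assms(5)] by (simp add: case_prod_beta')
  have hy: "(\<lambda>z. h z y) \<in> borel_measurable N" if "y \<in> space M" for y
    using measurable_Pair1[OF assms(5) that] by simp
  have fibre: "(\<integral>\<^sup>+z. ennreal (norm (h z y)) \<partial>N) \<le> ennreal (A * S powr (1 - 1 / enn2real p))"
    if "y \<in> space M" "Lp_norm N p (\<lambda>z. h z y) \<le> ennreal A" "0 \<le> A" for y A
    using Hoelder_inequality[OF pq hy[OF that(1)] borel_measurable_const that(2,3) Lp_norm_const_le[OF q S]]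
    by (simp add: s)
  have int: "integrable N (\<lambda>z. h z y)" "norm (\<integral>z. h z y \<partial>N) \<le> A * S powr (1 - 1 / enn2real p)"
    if y: "y \<in> space M" and A: "Lp_norm N p (\<lambda>z. h z y) \<le> ennreal A" "0 \<le> A" for y A
  proof -
    show i: "integrable N (\<lambda>z. h z y)"
      using fibre[OF that] hy[OF y] by (intro integrableI_bounded)
          (auto simp: le_less_trans[OF _ ennreal_less_top])
    have "ennreal (norm (\<integral>z. h z y \<partial>N)) \<le> (\<integral>\<^sup>+z. ennreal (norm (h z y)) \<partial>N)"
      by (rule integral_norm_bound_ennreal[OF i])
    also note fibre[OF that]
    finally show "norm (\<integral>z. h z y \<partial>N) \<le> A * S powr (1 - 1 / enn2real p)" using A by simp
  qed
  have [measurable]: "(\<lambda>y. \<integral>z. h z y \<partial>N) \<in> borel_measurable M"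
    using N.borel_measurable_lebesgue_integral[OF m] by simp
  have "(AE y in M. integrable N (\<lambda>z. h z y)) \<and> Lp_norm M p (\<lambda>y. \<integral>z. h z y \<partial>N)
      \<le> ennreal (S powr (1 - 1 / enn2real p) * C)"
  proof (cases "p = \<infinity>")
    case True
    have "AE w in N \<Otimes>\<^sub>M M. norm (case_prod h w) \<le> C" using h True by (simp add: Lp_norm_le_iff_infinity)
    then have "AE z in N. AE y in M. norm (h z y) \<le> C"
      using AE_pair by fastforce
    then have "AE y in M. AE z in N. norm (h z y) \<le> C"
      by (subst AE_commute[symmetric]) auto
    then have "AE y in M. Lp_norm N p (\<lambda>z. h z y) \<le> ennreal C \<and> y \<in> space M"
      using AE_space by eventually_elim (use True h hy in \<open>auto simp: Lp_norm_le_iff_infinity\<close>)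
    then have "AE y in M. integrable N (\<lambda>z. h z y) \<and> norm (\<integral>z. h z y \<partial>N) \<le> C * S powr (1 - 1 / enn2real p)"
      by eventually_elim (use int h in auto)
    then show ?thesis using True h S by (auto simp: Lp_norm_le_iff_infinity mult.commute)
  next
    case False
    define r where "r = enn2real p"
    have "r \<ge> 1" using assms(2) False unfolding r_def by (cases p) auto
    \<comment> \<open>\<open>J y\<close> is the \<open>p\<close>-th power of the norm of the fibre over \<open>y\<close>; it is finite almost everywhere.\<close>
    define J where "J = (\<lambda>y. \<integral>\<^sup>+z. ennreal (norm (h z y) powr r) \<partial>N)"
    have [measurable]: "J \<in> borel_measurable M"
      unfolding J_def by measurable
    have "(\<integral>\<^sup>+y. J y \<partial>M) = (\<integral>\<^sup>+w. ennreal (norm (case_prod h w) powr r) \<partial>(N \<Otimes>\<^sub>M M))"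
      using nn_integral_snd[of "\<lambda>(z, y). ennreal (norm (h z y) powr r)"]
      by (simp add: J_def case_prod_beta')
    also have "\<dots> \<le> ennreal (C powr r)"
      using h False assms(2) by (subst (asm) Lp_norm_le_iff_finite) (auto simp: r_def)
    finally have J: "(\<integral>\<^sup>+y. J y \<partial>M) \<le> ennreal (C powr r)" .
    then have fin: "AE y in M. J y \<noteq> \<infinity>"
      by (intro nn_integral_noteq_infinite) (auto simp: top_unique)
    have pt: "integrable N (\<lambda>z. h z y) \<and> ennreal (norm (\<integral>z. h z y \<partial>N) powr r)
        \<le> ennreal ((S powr (1 - 1 / r)) powr r) * J y"
      if y: "y \<in> space M" and Jy: "J y \<noteq> \<infinity>" for y
    proof -
      obtain j where j: "J y = ennreal j" "0 \<le> j" using Jy by (cases "J y") auto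
      have "Lp_norm N p (\<lambda>z. h z y) \<le> ennreal (j powr (1 / r))"
        using j \<open>r \<ge> 1\<close> False assms(2) hy[OF y]
        by (subst Lp_norm_le_iff_finite) (auto simp: r_def[symmetric] J_def powr_powr)
      note i = int[OF y this powr_ge_zero]
      have "norm (\<integral>z. h z y \<partial>N) powr r \<le> (j powr (1 / r) * S powr (1 - 1 / r)) powr r"
        using i(2) \<open>r \<ge> 1\<close> by (intro powr_mono2) (auto simp: r_def)
      also have "\<dots> = (S powr (1 - 1 / r)) powr r * j"
        using j \<open>r \<ge> 1\<close> by (simp add: powr_mult) (simp add: powr_powr)
      finally show ?thesis using i(1) j by (simp add: ennreal_mult[symmetric] ennreal_leI)
    qed
    have "AE y in M. ennreal (norm (\<integral>z. h z y \<partial>N) powr r) \<le> ennreal ((S powr (1 - 1 / r)) powr r) * J y"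
      using fin AE_space by eventually_elim (use pt in auto)
    then have "(\<integral>\<^sup>+y. ennreal (norm (\<integral>z. h z y \<partial>N) powr r) \<partial>M) \<le>
        (\<integral>\<^sup>+y. ennreal ((S powr (1 - 1 / r)) powr r) * J y \<partial>M)"
      by (rule nn_integral_mono_AE)
    also have "\<dots> = ennreal ((S powr (1 - 1 / r)) powr r) * (\<integral>\<^sup>+y. J y \<partial>M)"
      by (rule nn_integral_cmult) measurable
    also have "\<dots> \<le> ennreal ((S powr (1 - 1 / r)) powr r) * ennreal (C powr r)"
      using J by (intro mult_left_mono) auto
    also have "\<dots> = ennreal ((S powr (1 - 1 / r) * C) powr r)"
      using h by (simp add: powr_mult ennreal_mult)
    finally have "Lp_norm M p (\<lambda>y. \<integral>z. h z y \<partial>N) \<le> ennreal (S powr (1 - 1 / r) * C)"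
      using False assms(2) h S by (subst Lp_norm_le_iff_finite) (auto simp: r_def)
    moreover have "AE y in M. integrable N (\<lambda>z. h z y)"
      using fin AE_space by eventually_elim (use pt in auto)
    ultimately show ?thesis by (simp add: r_def)
  qed
  then show "AE y in M. integrable N (\<lambda>z. h z y)"
    "Lp_norm M p (\<lambda>y. \<integral>z. h z y \<partial>N) \<le> ennreal (S powr (1 - 1 / enn2real p) * C)" by auto
qed

section \<open>Superpositions of rank-one operators\<close>

lemma borel_measurable_cnj [measurable]: "cnj \<in> borel_measurable borel"
  by (intro borel_measurable_continuous_onI continuous_intros)

lemma Lp_pairing_bound:
  fixes f u :: "'a \<Rightarrow> complex"
  assumes pq: "conjugate_exponents p q"
    and [measurable]: "f \<in> borel_measurable M" "u \<in> borel_measurable M"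
    and f: "Lp_norm M p f \<le> ennreal A" "0 \<le> A" and u: "Lp_norm M q u \<le> ennreal U" "0 \<le> U"
  shows "integrable M (\<lambda>y. f y * cnj (u y))" and "norm (\<integral>y. f y * cnj (u y) \<partial>M) \<le> A * U"
proof -
  have *: "(\<integral>\<^sup>+y. ennreal (norm (f y * cnj (u y))) \<partial>M) \<le> ennreal (A * U)"
    using Hoelder_inequality[OF assms] by (simp add: norm_mult)
  then show i: "integrable M (\<lambda>y. f y * cnj (u y))"
    by (intro integrableI_bounded) (auto simp: le_less_trans[OF _ ennreal_less_top])
  have "ennreal (norm (\<integral>y. f y * cnj (u y) \<partial>M)) \<le> (\<integral>\<^sup>+y. ennreal (norm (f y * cnj (u y))) \<partial>M)"
    by (rule integral_norm_bound_ennreal[OF i])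
  also note *
  finally show "norm (\<integral>y. f y * cnj (u y) \<partial>M) \<le> A * U" using f u by simp
qed

text \<open>
  The weight \<open>\<sigma>\<close> is split into its modulus, which becomes the density of a finite measure \<open>D\<close> of mass \<open>S\<close>,
  and its phase \<open>sgn \<sigma>\<close>, which joins the kernel. Each fibre of the new kernel is a multiple of \<open>v z\<close> by
  a number of modulus at most \<open>A * U z\<close>, hence has norm at most \<open>A * K\<close>. The powers
  \<open>S powr (1 / p)\<close> from \<open>Lp_norm_fibrewise_le\<close> and \<open>S powr (1 - 1 / p)\<close> from
  \<open>Lp_norm_integral_le\<close> combine to \<open>S\<close>.
\<close>

lemma Lp_norm_superposition_le:
  fixes u v :: "'z \<Rightarrow> 'a \<Rightarrow> complex" and \<sigma> :: "'z \<Rightarrow> complex"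
  assumes M: "sigma_finite_measure M" and N: "sigma_finite_measure N" and pq: "conjugate_exponents p q"
    and [measurable]: "case_prod u \<in> borel_measurable (N \<Otimes>\<^sub>M M)" "case_prod v \<in> borel_measurable (N \<Otimes>\<^sub>M M)"
      "\<sigma> \<in> borel_measurable N" "f \<in> borel_measurable M"
    and S: "(\<integral>\<^sup>+z. ennreal (norm (\<sigma> z)) \<partial>N) = ennreal S" "0 \<le> S"
    and u: "\<And>z. z \<in> space N \<Longrightarrow> Lp_norm M q (u z) \<le> ennreal (U z)" "\<And>z. 0 \<le> U z"
    and v: "\<And>z. z \<in> space N \<Longrightarrow> Lp_norm M p (v z) \<le> ennreal (V z)" "\<And>z. 0 \<le> V z"
    and UV: "\<And>z. z \<in> space N \<Longrightarrow> U z * V z \<le> K" "0 \<le> K"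
    and f: "Lp_norm M p f \<le> ennreal A" "0 \<le> A"
  defines "k \<equiv> \<lambda>y z. \<sigma> z * (\<integral>x. f x * cnj (u z x) \<partial>M) * v z y"
  shows "AE y in M. integrable N (k y)"
    and "Lp_norm M p (\<lambda>y. \<integral>z. k y z \<partial>N) \<le> ennreal (S * (A * K))"
    and "(\<lambda>y. \<integral>z. k y z \<partial>N) \<in> borel_measurable M"
proof -
  interpret M: sigma_finite_measure M by fact
  interpret N: sigma_finite_measure N by fact
  have p: "1 \<le> p" using pq by (simp add: conjugate_exponents_def)
  define c where "c = (\<lambda>z. \<integral>x. f x * cnj (u z x) \<partial>M)"
  define D where "D = density N (\<lambda>z. ennreal (norm (\<sigma> z)))"
  define h where "h = (\<lambda>z y. (sgn (\<sigma> z) * c z) * v z y)"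
  have [measurable]: "c \<in> borel_measurable N"
    unfolding c_def by measurable
  have uz: "u z \<in> borel_measurable M" and vz: "v z \<in> borel_measurable M" if "z \<in> space N" for z
    using that measurable_Pair2[OF assms(4) that] measurable_Pair2[OF assms(5) that] by simp_all
  have [measurable_cong, simp]: "sets D = sets N" and space_D: "space D = space N" by (simp_all add: D_def)
  have D: "emeasure D (space D) = ennreal S"
    unfolding D_def by (subst emeasure_density) (auto simp: S(1)[symmetric] intro!: nn_integral_cong)
  have c: "norm (c z) \<le> A * U z" if "z \<in> space N" for z
    unfolding c_def using Lp_pairing_bound(2)[OF pq _ uz[OF that] f u(1)[OF that] u(2)] by simp
  have [measurable]: "case_prod h \<in> borel_measurable (N \<Otimes>\<^sub>M M)"
    unfolding h_def sgn_div_norm by measurable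
  then have hm: "case_prod h \<in> borel_measurable (D \<Otimes>\<^sub>M M)" by (simp cong: measurable_cong_sets)
  have h: "Lp_norm M p (h z) \<le> ennreal (A * K)" if "z \<in> space D" for z
  proof -
    have z: "z \<in> space N" using that by (simp add: space_D)
    have "Lp_norm M p (h z) \<le> ennreal (norm (sgn (\<sigma> z) * c z) * V z)"
      unfolding h_def using Lp_norm_cmult_le[OF vz[OF z] p v(1)[OF z] v(2)] .
    also have "norm (sgn (\<sigma> z) * c z) * V z \<le> (1 * (A * U z)) * V z"
      using c[OF z] v(2)[of z] unfolding norm_mult by (intro mult_right_mono mult_mono) (auto simp: norm_sgn)
    also have "\<dots> \<le> A * K" using mult_left_mono[OF UV(1)[OF z] f(2)] by (simp add: mult.assoc)
    finally show ?thesis by (simp add: ennreal_leI)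
  qed
  have hp: "Lp_norm (D \<Otimes>\<^sub>M M) p (case_prod h) \<le> ennreal (S powr (1 / enn2real p) * (A * K))"
    using UV f by (intro Lp_norm_fibrewise_le[OF M p D S(2) hm h]) auto
  have nn: "0 \<le> S powr (1 / enn2real p) * (A * K)" using UV f by simp
  note D_le = Lp_norm_integral_le[OF M p D S(2) hm hp nn]
  have k_eq: "k y z = norm (\<sigma> z) *\<^sub>R h z y" for y z
  proof -
    have "norm (\<sigma> z) *\<^sub>R sgn (\<sigma> z) = \<sigma> z"
      by (cases "\<sigma> z = 0") (simp_all add: sgn_div_norm)
    then have "k y z = (norm (\<sigma> z) *\<^sub>R sgn (\<sigma> z)) * c z * v z y" by (simp add: k_def c_def)
    then show ?thesis by (simp add: h_def mult.assoc)
  qed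
  have hy: "(\<lambda>z. h z y) \<in> borel_measurable N" if "y \<in> space M" for y
    using measurable_Pair1[OF _ that, of "case_prod h" N borel] by simp
  show "AE y in M. integrable N (k y)"
    using D_le(1) AE_space
  proof eventually_elim
    case (elim y)
    then show ?case unfolding k_eq D_def
      by (subst (asm) integrable_density) (use hy in auto)
  qed
  have eq: "(\<integral>z. k y z \<partial>N) = (\<integral>z. h z y \<partial>D)" if "y \<in> space M" for y
    unfolding k_eq D_def by (subst integral_density) (use hy[OF that] in auto)
  have "S powr (1 - 1 / enn2real p) * (S powr (1 / enn2real p) * (A * K)) = S * (A * K)"
    using S(2) by (simp add: mult.assoc[symmetric] powr_add[symmetric])
  then have "Lp_norm M p (\<lambda>y. \<integral>z. h z y \<partial>D) \<le> ennreal (S * (A * K))" using D_le(2) by (simp only:)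
  moreover have "Lp_norm M p (\<lambda>y. \<integral>z. k y z \<partial>N) = Lp_norm M p (\<lambda>y. \<integral>z. h z y \<partial>D)"
    using eq by (intro Lp_norm_cong) auto
  ultimately show "Lp_norm M p (\<lambda>y. \<integral>z. k y z \<partial>N) \<le> ennreal (S * (A * K))" by simp
  have "(\<lambda>(y, z). k y z) \<in> borel_measurable (M \<Otimes>\<^sub>M N)"
  proof -
    have "(\<lambda>w. v (snd w) (fst w)) \<in> borel_measurable (M \<Otimes>\<^sub>M N)"
      using measurable_compose[OF measurable_pair_swap' assms(5)] by (simp add: case_prod_beta')
    then show ?thesis unfolding k_def c_def[symmetric] case_prod_beta' by measurable
  qed
  then show "(\<lambda>y. \<integral>z. k y z \<partial>N) \<in> borel_measurable M"
    by (rule N.borel_measurable_lebesgue_integral)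
qed

section \<open>The measures of the half-space\<close>

lemma nn_integral_lborel_translate:
  fixes F :: "'a::euclidean_space \<Rightarrow> ennreal"
  assumes [measurable]: "F \<in> borel_measurable borel"
  shows "(\<integral>\<^sup>+x. F (c + x) \<partial>lborel) = (\<integral>\<^sup>+x. F x \<partial>lborel)"
  by (subst (2) lborel_distr_plus[of c, symmetric]) (simp add: nn_integral_distr)

lemma nn_integral_lborel_scaleR:
  fixes F :: "'a::euclidean_space \<Rightarrow> ennreal"
  assumes [measurable]: "F \<in> borel_measurable borel" and "0 < a"
  shows "(\<integral>\<^sup>+x. F (x /\<^sub>R a) \<partial>lborel) = ennreal (a ^ DIM('a)) * (\<integral>\<^sup>+x. F x \<partial>lborel)"
proof -
  have "(\<integral>\<^sup>+x. F (x /\<^sub>R a) \<partial>lborel) = (\<integral>\<^sup>+x. F (x /\<^sub>R a)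
      \<partial>density (distr lborel borel (\<lambda>x::'a. 0 + a *\<^sub>R x)) (\<lambda>_. ennreal (\<bar>a\<bar> ^ DIM('a))))"
    using lborel_affine[of a "0::'a"] \<open>0 < a\<close> by simp
  also have "\<dots> = ennreal (a ^ DIM('a)) * (\<integral>\<^sup>+x. F x \<partial>lborel)"
    using \<open>0 < a\<close> by (simp add: nn_integral_density nn_integral_distr nn_integral_cmult)
  finally show ?thesis .
qed

lemma nn_integral_lborel_pair:
  fixes g :: "'a::euclidean_space \<times> 'b::euclidean_space \<Rightarrow> ennreal"
  assumes "g \<in> borel_measurable borel"
  shows "(\<integral>\<^sup>+y. g y \<partial>lborel) = (\<integral>\<^sup>+s. \<integral>\<^sup>+t. g (s, t) \<partial>lborel \<partial>lborel)"
  using lborel.nn_integral_fst[of g lborel] assms by (simp add: lborel_prod)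

lemma borel_measurable_fst_borel [measurable]:
  "fst \<in> borel_measurable (borel :: ('a::second_countable_topology \<times> 'b::second_countable_topology) measure)"
  by (intro borel_measurable_continuous_onI continuous_intros)

lemma borel_measurable_snd_borel [measurable]:
  "snd \<in> borel_measurable (borel :: ('a::second_countable_topology \<times> 'b::second_countable_topology) measure)"
  by (intro borel_measurable_continuous_onI continuous_intros)

lemma half_space_borel [measurable]: "(half_space :: 'd::finite hpoint set) \<in> sets borel"
  unfolding half_space_def by (intro borel_open open_Collect_less continuous_intros)

lemma sets_weinstein_measure [measurable_cong]:
  "sets (weinstein_measure \<alpha> :: 'd::finite hpoint measure) = sets (restrict_space borel half_space)"
  by (simp add: weinstein_measure_def sets_restrict_space)

lemma space_weinstein_measure [simp]: "space (weinstein_measure \<alpha>) = half_space"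
  by (simp add: weinstein_measure_def space_restrict_space)

lemma sets_weinstein_scale_measure [measurable_cong]:
  "sets (weinstein_scale_measure \<alpha> :: (real \<times> 'd::finite hpoint) measure)
    = sets (restrict_space borel {0<..} \<Otimes>\<^sub>M weinstein_measure \<alpha>)"
  by (simp add: weinstein_scale_measure_def cong: sets_pair_measure_cong) 
    (intro sets_pair_measure_cong, auto simp: sets_restrict_space)

lemma space_weinstein_scale_measure [simp]:
  "space (weinstein_scale_measure \<alpha>) = {0<..} \<times> half_space"
  by (simp add: weinstein_scale_measure_def space_pair_measure space_restrict_space)

lemma sigma_finite_weinstein_measure: "sigma_finite_measure (weinstein_measure \<alpha> :: 'd::finite hpoint measure)"
proof -
  interpret sigma_finite_measure "restrict_space lborel (half_space :: 'd hpoint set)"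
    by (rule sigma_finite_measure_restrict_space) (auto intro: sigma_finite_lborel)
  show ?thesis unfolding weinstein_measure_def
    by (subst sigma_finite_iff_density_finite)
      (auto intro!: measurable_restrict_space1)
qed

lemma sigma_finite_weinstein_scale_measure:
  "sigma_finite_measure (weinstein_scale_measure \<alpha> :: (real \<times> 'd::finite hpoint) measure)"
proof -
  interpret R: sigma_finite_measure "restrict_space lborel {0::real<..}"
    by (rule sigma_finite_measure_restrict_space) (auto intro: sigma_finite_lborel)
  interpret W: sigma_finite_measure "weinstein_measure \<alpha> :: 'd hpoint measure"
    by (rule sigma_finite_weinstein_measure)
  interpret pair_sigma_finite "restrict_space lborel {0::real<..}" "weinstein_measure \<alpha> :: 'd hpoint measure" ..
  have "(\<lambda>a. a) \<in> restrict_space lborel {0::real<..} \<rightarrow>\<^sub>M borel" by (rule measurable_restrict_space1) simp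
  then have "(\<lambda>w. fst w) \<in> restrict_space lborel {0::real<..} \<Otimes>\<^sub>M (weinstein_measure \<alpha> :: 'd hpoint measure)
      \<rightarrow>\<^sub>M borel"
    by (rule measurable_compose[OF measurable_fst])
  then show ?thesis unfolding weinstein_scale_measure_def case_prod_beta'
    by (subst sigma_finite_iff_density_finite) auto
qed

definition weinstein_const :: "real \<Rightarrow> nat \<Rightarrow> real" where
  "weinstein_const \<alpha> d = (2 * pi) ^ d * 2 powr (2 * \<alpha>) * (Gamma (\<alpha> + 1))\<^sup>2"

lemma nn_integral_weinstein_measure:
  fixes g :: "'d::finite hpoint \<Rightarrow> ennreal"
  assumes [measurable]: "g \<in> borel_measurable borel"
  shows "(\<integral>\<^sup>+y. g y \<partial>weinstein_measure \<alpha>) = ennreal (1 / weinstein_const \<alpha> CARD('d)) *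
    (\<integral>\<^sup>+y'. \<integral>\<^sup>+t. indicator {0<..} t * ennreal (t powr (2 * \<alpha> + 1)) * g (y', t) \<partial>lborel \<partial>lborel)"
proof -
  define K where "K = weinstein_const \<alpha> CARD('d)"
  have "K \<ge> 0" by (simp add: K_def weinstein_const_def)
  have [measurable]: "g \<in> borel_measurable (restrict_space lborel half_space)"
    by (rule measurable_restrict_space1) simp
  have [measurable]: "(\<lambda>x. snd x) \<in> borel_measurable (restrict_space lborel (half_space :: 'd hpoint set))"
    by (rule measurable_restrict_space1) simp
  have "(\<integral>\<^sup>+y. g y \<partial>weinstein_measure \<alpha>) = (\<integral>\<^sup>+y. ennreal (snd y powr (2 * \<alpha> + 1) / K) * g y
      \<partial>restrict_space lborel half_space)"
    unfolding weinstein_measure_def K_def weinstein_const_def by (subst nn_integral_density) auto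
  also have "\<dots> = (\<integral>\<^sup>+y. ennreal (snd y powr (2 * \<alpha> + 1) / K) * g y * indicator half_space y \<partial>lborel)"
    by (subst nn_integral_restrict_space) auto
  also have "\<dots> = (\<integral>\<^sup>+y. ennreal (1 / K) * (indicator {0<..} (snd y) * ennreal (snd y powr (2 * \<alpha> + 1))
      * g y) \<partial>lborel)"
  proof (rule nn_integral_cong)
    fix y :: "'d hpoint"
    have "ennreal (snd y powr (2 * \<alpha> + 1) / K) = ennreal (1 / K) * ennreal (snd y powr (2 * \<alpha> + 1))"
      using \<open>K \<ge> 0\<close> by (subst ennreal_mult[symmetric]) auto
    then show "ennreal (snd y powr (2 * \<alpha> + 1) / K) * g y * indicator half_space y
      = ennreal (1 / K) * (indicator {0<..} (snd y) * ennreal (snd y powr (2 * \<alpha> + 1)) * g y)"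
      by (auto simp: half_space_def mult_ac split: split_indicator)
  qed
  also have "\<dots> = ennreal (1 / K) * (\<integral>\<^sup>+y. indicator {0<..} (snd y) * ennreal (snd y powr (2 * \<alpha> + 1)) * g y
      \<partial>lborel)"
    by (rule nn_integral_cmult) measurable
  also have "(\<integral>\<^sup>+y. indicator {0<..} (snd y) * ennreal (snd y powr (2 * \<alpha> + 1)) * g y
      \<partial>(lborel :: 'd hpoint measure))
    = (\<integral>\<^sup>+y'. \<integral>\<^sup>+t. indicator {0<..} t * ennreal (t powr (2 * \<alpha> + 1)) * g (y', t) \<partial>lborel \<partial>lborel)"
    by (subst nn_integral_lborel_pair) auto
  finally show ?thesis by (simp add: K_def)
qed

text \<open>
  The density contributes \<open>a powr (2\<alpha> + 1)\<close> and Lebesgue measure in dimension \<open>d + 1\<close> contributes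
  \<open>a powr (d + 1)\<close>.
\<close>

lemma nn_integral_weinstein_dilate:
  fixes g :: "'d::finite hpoint \<Rightarrow> ennreal"
  assumes g[measurable]: "g \<in> borel_measurable (weinstein_measure \<alpha>)" and a: "0 < a"
  shows "(\<integral>\<^sup>+y. g (y /\<^sub>R a) \<partial>weinstein_measure \<alpha>)
    = ennreal (a powr (2 * \<alpha> + real CARD('d) + 2)) * (\<integral>\<^sup>+y. g y \<partial>weinstein_measure \<alpha>)"
proof -
  \<comment> \<open>Outside the half-space \<open>g\<close> is unconstrained; cutting it off there gives a Borel function on the whole
      space.\<close>
  define G where "G = (\<lambda>y. g y * indicator half_space y)"
  have [measurable]: "G \<in> borel_measurable borel"
    using g unfolding G_def measurable_cong_sets[OF sets_weinstein_measure refl]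
    by (subst (asm) borel_measurable_restrict_space_iff_ennreal) auto
  have gG: "g y = G y" if "y \<in> half_space" for y using that by (simp add: G_def)
  define W where "W = (\<lambda>y. indicator {0<..} (snd y) * ennreal (snd y powr (2 * \<alpha> + 1)) * G y)"
  have [measurable]: "W \<in> borel_measurable borel"
    unfolding W_def by measurable
  have "(\<integral>\<^sup>+y. g (y /\<^sub>R a) \<partial>weinstein_measure \<alpha>) = (\<integral>\<^sup>+y. G (y /\<^sub>R a) \<partial>weinstein_measure \<alpha>)"
    using a by (intro nn_integral_cong gG) (auto simp: half_space_def)
  also have "\<dots> = ennreal (1 / weinstein_const \<alpha> CARD('d)) *
    (\<integral>\<^sup>+y'. \<integral>\<^sup>+t. indicator {0<..} t * ennreal (t powr (2 * \<alpha> + 1)) * G ((y', t) /\<^sub>R a) \<partial>lborel \<partial>lborel)"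
    by (rule nn_integral_weinstein_measure) measurable
  also have "(\<integral>\<^sup>+y'. \<integral>\<^sup>+t. indicator {0<..} t * ennreal (t powr (2 * \<alpha> + 1)) * G ((y', t) /\<^sub>R a) \<partial>lborel
      \<partial>lborel)
    = (\<integral>\<^sup>+y'. \<integral>\<^sup>+t. ennreal (a powr (2 * \<alpha> + 1)) * W ((y', t) /\<^sub>R a) \<partial>lborel \<partial>lborel)"
  proof (intro nn_integral_cong)
    fix y' :: "real ^ 'd" and t :: real
    show "indicator {0<..} t * ennreal (t powr (2 * \<alpha> + 1)) * G ((y', t) /\<^sub>R a)
        = ennreal (a powr (2 * \<alpha> + 1)) * W ((y', t) /\<^sub>R a)"
    proof (cases "t > 0")
      case True
      have "t powr (2 * \<alpha> + 1) = a powr (2 * \<alpha> + 1) * (t /\<^sub>R a) powr (2 * \<alpha> + 1)"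
        using True a by (simp add: powr_mult[symmetric] field_simps)
      then have "ennreal (t powr (2 * \<alpha> + 1)) = ennreal (a powr (2 * \<alpha> + 1))
          * ennreal ((t /\<^sub>R a) powr (2 * \<alpha> + 1))"
        by (simp add: ennreal_mult)
      then show ?thesis using True a by (simp add: W_def mult.assoc)
    qed (use a in \<open>simp add: W_def zero_less_mult_iff\<close>)
  qed
  also have "\<dots> = (\<integral>\<^sup>+y. ennreal (a powr (2 * \<alpha> + 1)) * W (y /\<^sub>R a) \<partial>lborel)"
    by (rule nn_integral_lborel_pair[symmetric]) measurable
  also have "\<dots> = ennreal (a powr (2 * \<alpha> + 1)) * (\<integral>\<^sup>+y. W (y /\<^sub>R a) \<partial>lborel)"
    by (rule nn_integral_cmult) measurable
  also have "\<dots> = ennreal (a powr (2 * \<alpha> + 1)) * (ennreal (a ^ DIM('d hpoint)) * (\<integral>\<^sup>+y. W y \<partial>lborel))"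
    using a by (subst nn_integral_lborel_scaleR) auto
  also have "(\<integral>\<^sup>+y. W y \<partial>lborel) = (\<integral>\<^sup>+y'. \<integral>\<^sup>+t. indicator {0<..} t * ennreal (t powr (2 * \<alpha> + 1))
      * G (y', t) \<partial>lborel \<partial>lborel)"
    by (subst nn_integral_lborel_pair) (simp_all add: W_def)
  also have "ennreal (a powr (2 * \<alpha> + 1)) * (ennreal (a ^ DIM('d hpoint)) *
      (\<integral>\<^sup>+y'. \<integral>\<^sup>+t. indicator {0<..} t * ennreal (t powr (2 * \<alpha> + 1)) * G (y', t) \<partial>lborel \<partial>lborel))
    = ennreal (a powr (2 * \<alpha> + real CARD('d) + 2)) *
        (\<integral>\<^sup>+y'. \<integral>\<^sup>+t. indicator {0<..} t * ennreal (t powr (2 * \<alpha> + 1)) * G (y', t) \<partial>lborel \<partial>lborel)"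
  proof -
    have "a ^ DIM('d hpoint) = a powr (real CARD('d) + 1)"
      using a by (simp add: powr_add powr_realpow mult.commute)
    then have "a powr (2 * \<alpha> + 1) * a ^ DIM('d hpoint) = a powr (2 * \<alpha> + real CARD('d) + 2)"
      using a by (simp only: powr_add[symmetric]) (simp add: algebra_simps)
    then have "ennreal (a powr (2 * \<alpha> + 1)) * ennreal (a ^ DIM('d hpoint))
        = ennreal (a powr (2 * \<alpha> + real CARD('d) + 2))"
      using a by (metis ennreal_mult powr_ge_zero zero_le_power less_imp_le)
    then show ?thesis by (simp only: mult.assoc[symmetric])
  qed
  also have "ennreal (1 / weinstein_const \<alpha> CARD('d)) * (ennreal (a powr (2 * \<alpha> + real CARD('d) + 2)) *
      (\<integral>\<^sup>+y'. \<integral>\<^sup>+t. indicator {0<..} t * ennreal (t powr (2 * \<alpha> + 1)) * G (y', t) \<partial>lborel \<partial>lborel))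
    = ennreal (a powr (2 * \<alpha> + real CARD('d) + 2)) * (\<integral>\<^sup>+y. G y \<partial>weinstein_measure \<alpha>)"
    by (subst nn_integral_weinstein_measure) (simp_all only: mult_ac, measurable)
  also have "(\<integral>\<^sup>+y. G y \<partial>weinstein_measure \<alpha>) = (\<integral>\<^sup>+y. g y \<partial>weinstein_measure \<alpha>)"
    by (intro nn_integral_cong gG[symmetric]) simp
  finally show ?thesis .
qed

section \<open>Generalized translation as an average over angles\<close>

definition angular_measure :: "real \<Rightarrow> real measure" where
  "angular_measure \<alpha> = density (restrict_space lborel {0<..<pi})
     (\<lambda>\<theta>. ennreal (Gamma (\<alpha> + 1) / (sqrt pi * Gamma (\<alpha> + 1 / 2)) * sin \<theta> powr (2 * \<alpha>)))"

lemma sets_angular_measure [measurable_cong]: "sets (angular_measure \<alpha>) = sets (restrict_space borel {0<..<pi})"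
  by (simp add: angular_measure_def sets_restrict_space)

lemma space_angular_measure [simp]: "space (angular_measure \<alpha>) = {0<..<pi}"
  by (simp add: angular_measure_def space_restrict_space)

lemma translation_const_nonneg:
  assumes "\<alpha> > - 1 / 2"
  shows "0 \<le> Gamma (\<alpha> + 1) / (sqrt pi * Gamma (\<alpha> + 1 / 2))"
  using assms by (intro divide_nonneg_pos mult_pos_pos less_imp_le[OF Gamma_real_pos] Gamma_real_pos) auto

lemma nn_integral_angular_measure:
  fixes g :: "real \<Rightarrow> ennreal"
  assumes \<alpha>: "\<alpha> > - 1 / 2" and [measurable]: "g \<in> borel_measurable borel"
  shows "(\<integral>\<^sup>+\<theta>. g \<theta> \<partial>angular_measure \<alpha>) = ennreal (Gamma (\<alpha> + 1) / (sqrt pi * Gamma (\<alpha> + 1 / 2))) *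
    (\<integral>\<^sup>+\<theta>. indicator {0<..<pi} \<theta> * ennreal (sin \<theta> powr (2 * \<alpha>)) * g \<theta> \<partial>lborel)"
proof -
  define c where "c = Gamma (\<alpha> + 1) / (sqrt pi * Gamma (\<alpha> + 1 / 2))"
  have "c \<ge> 0" unfolding c_def by (rule translation_const_nonneg[OF \<alpha>])
  have [measurable]: "g \<in> borel_measurable (restrict_space lborel {0<..<pi})"
    by (rule measurable_restrict_space1) simp
  have [measurable]: "(\<lambda>\<theta>. ennreal (c * sin \<theta> powr (2 * \<alpha>)))
      \<in> borel_measurable (restrict_space lborel {0<..<pi})"
    by (rule measurable_restrict_space1) simp
  have "(\<integral>\<^sup>+\<theta>. g \<theta> \<partial>angular_measure \<alpha>) = (\<integral>\<^sup>+\<theta>. ennreal (c * sin \<theta> powr (2 * \<alpha>)) * g \<theta>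
      \<partial>restrict_space lborel {0<..<pi})"
    unfolding angular_measure_def c_def[symmetric] by (rule nn_integral_density) measurable
  also have "\<dots> = (\<integral>\<^sup>+\<theta>. ennreal (c * sin \<theta> powr (2 * \<alpha>)) * g \<theta> * indicator {0<..<pi} \<theta> \<partial>lborel)"
    by (rule nn_integral_restrict_space) simp
  also have "\<dots> = (\<integral>\<^sup>+\<theta>. ennreal c * (indicator {0<..<pi} \<theta> * ennreal (sin \<theta> powr (2 * \<alpha>)) * g \<theta>) \<partial>lborel)"
    using \<open>c \<ge> 0\<close> by (intro nn_integral_cong) (simp add: ennreal_mult mult_ac)
  also have "\<dots> = ennreal c * (\<integral>\<^sup>+\<theta>. indicator {0<..<pi} \<theta> * ennreal (sin \<theta> powr (2 * \<alpha>)) * g \<theta> \<partial>lborel)"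
    by (rule nn_integral_cmult) measurable
  finally show ?thesis by (simp add: c_def)
qed

text \<open>
  The constant in the generalized translation is the reciprocal of the total mass of the angular weight.
\<close>

lemma translation_const_normalizes:
  assumes \<alpha>: "\<alpha> > - 1 / 2"
  shows "ennreal (Gamma (\<alpha> + 1) / (sqrt pi * Gamma (\<alpha> + 1 / 2))) *
    (\<integral>\<^sup>+\<theta>. indicator {0<..<pi} \<theta> * ennreal (sin \<theta> powr (2 * \<alpha>)) \<partial>lborel) = 1"
proof -
  have pos: "Gamma (\<alpha> + 1) > 0" "Gamma (\<alpha> + 1 / 2) > 0"
    using \<alpha> by (auto intro!: Gamma_real_pos)
  then have "ennreal (Gamma (\<alpha> + 1) / (sqrt pi * Gamma (\<alpha> + 1 / 2)))
      * ennreal (sqrt pi * Gamma (\<alpha> + 1/2) / Gamma (\<alpha> + 1)) = 1"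
    by (subst ennreal_mult[symmetric]) auto
  then show ?thesis using nn_integral_sin_powr[OF \<alpha>] by simp
qed

lemma emeasure_angular_measure:
  assumes \<alpha>: "\<alpha> > - 1 / 2"
  shows "emeasure (angular_measure \<alpha>) (space (angular_measure \<alpha>)) = 1"
proof -
  have "emeasure (angular_measure \<alpha>) (space (angular_measure \<alpha>)) = (\<integral>\<^sup>+\<theta>. 1 \<partial>angular_measure \<alpha>)"
    by simp
  also have "\<dots> = 1"
    using translation_const_normalizes[OF \<alpha>] by (subst nn_integral_angular_measure[OF \<alpha>]) auto
  finally show ?thesis .
qed

definition translated_point :: "'d::finite hpoint \<Rightarrow> 'd hpoint \<Rightarrow> real \<Rightarrow> 'd hpoint" where
  "translated_point x y \<theta> = (fst x + fst y, sqrt ((snd x)\<^sup>2 + (snd y)\<^sup>2 + 2 * snd x * snd y * cos \<theta>))"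

text \<open>
  The last coordinate is the length of the third side of a triangle in which the sides \<open>snd x\<close> and
  \<open>snd y\<close> enclose the angle \<open>pi - \<theta>\<close>, and this triangle is not degenerate for \<open>0 < \<theta> < pi\<close>.
\<close>

lemma translated_point_in_half_space:
  assumes "x \<in> half_space" "y \<in> half_space" "\<theta> \<in> {0<..<pi}"
  shows "translated_point x y \<theta> \<in> half_space"
proof -
  have s: "sin \<theta> > 0" using assms by (auto intro: sin_gt_zero)
  have "(snd x)\<^sup>2 + (snd y)\<^sup>2 + 2 * snd x * snd y * cos \<theta>
    = (snd x)\<^sup>2 + (snd y)\<^sup>2 * ((sin \<theta>)\<^sup>2 + (cos \<theta>)\<^sup>2) + 2 * snd x * snd y * cos \<theta>"
    by simp
  also have "\<dots> = (snd x + snd y * cos \<theta>)\<^sup>2 + (snd y * sin \<theta>)\<^sup>2"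
    by algebra
  also have "\<dots> > 0"
    using s assms by (intro add_nonneg_pos) (auto simp: half_space_def)
  finally show ?thesis by (simp add: translated_point_def half_space_def)
qed

lemma measurable_translated_point:
  assumes [measurable]: "X \<in> M \<rightarrow>\<^sub>M weinstein_measure \<alpha>" "Y \<in> M \<rightarrow>\<^sub>M weinstein_measure \<beta>" "T
      \<in> M \<rightarrow>\<^sub>M angular_measure \<gamma>"
  shows "(\<lambda>w. translated_point (X w) (Y w) (T w)) \<in> M \<rightarrow>\<^sub>M (weinstein_measure \<delta> :: 'd::finite hpoint measure)"
proof -
  have id_H: "(\<lambda>x. x) \<in> weinstein_measure \<alpha> \<rightarrow>\<^sub>M (borel :: 'd hpoint measure)" for \<alpha>
    unfolding measurable_cong_sets[OF sets_weinstein_measure refl] by (rule measurable_restrict_space1) simp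
  have id_A: "(\<lambda>x. x) \<in> angular_measure \<gamma> \<rightarrow>\<^sub>M borel"
    unfolding measurable_cong_sets[OF sets_angular_measure refl] by (rule measurable_restrict_space1) simp
  have [measurable]: "X \<in> M \<rightarrow>\<^sub>M borel" "Y \<in> M \<rightarrow>\<^sub>M borel" "T \<in> M \<rightarrow>\<^sub>M borel"
    using measurable_compose[OF assms(1) id_H] measurable_compose[OF assms(2) id_H] measurable_compose[OF
        assms(3) id_A]
    by simp_all
  have "(\<lambda>w. translated_point (X w) (Y w) (T w)) \<in> M \<rightarrow>\<^sub>M borel \<Otimes>\<^sub>M borel"
    unfolding translated_point_def by measurable
  then have "(\<lambda>w. translated_point (X w) (Y w) (T w)) \<in> M \<rightarrow>\<^sub>M borel"
    by (simp add: borel_prod)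
  moreover have "translated_point (X w) (Y w) (T w) \<in> half_space" if "w \<in> space M" for w
    using that measurable_space[OF assms(1)] measurable_space[OF assms(2)] measurable_space[OF assms(3)]
    by (intro translated_point_in_half_space) auto
  ultimately show ?thesis
    unfolding measurable_cong_sets[OF refl sets_weinstein_measure]
    by (intro measurable_restrict_space2) auto
qed

lemma weinstein_translation_eq_angular_mean:
  assumes \<alpha>: "\<alpha> > - 1 / 2" and \<phi>: "\<phi> \<in> borel_measurable (weinstein_measure \<alpha>)" and xy: "x \<in> half_space" "y
      \<in> half_space"
  shows "weinstein_translation \<alpha> x \<phi> y = (\<integral>\<theta>. \<phi> (translated_point x y \<theta>) \<partial>angular_measure \<alpha>)"
proof -
  define c where "c = Gamma (\<alpha> + 1) / (sqrt pi * Gamma (\<alpha> + 1 / 2))"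
  have "c \<ge> 0" unfolding c_def by (rule translation_const_nonneg[OF \<alpha>])
  have "(\<lambda>\<theta>. translated_point x y \<theta>) \<in> angular_measure \<alpha> \<rightarrow>\<^sub>M weinstein_measure \<alpha>"
    by (rule measurable_translated_point[where \<alpha>=\<alpha> and \<beta>=\<alpha> and \<gamma>=\<alpha>]) (use xy in auto)
  then have "(\<lambda>\<theta>. \<phi> (translated_point x y \<theta>)) \<in> borel_measurable (angular_measure \<alpha>)"
    using \<phi> by (rule measurable_compose)
  then have m: "(\<lambda>\<theta>. \<phi> (translated_point x y \<theta>)) \<in> borel_measurable (restrict_space lborel {0<..<pi})"
    by (simp add: angular_measure_def)
  have w: "(\<lambda>\<theta>. c * sin \<theta> powr (2 * \<alpha>)) \<in> borel_measurable (restrict_space lborel {0<..<pi})"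
    by (rule measurable_restrict_space1) simp
  have "(\<integral>\<theta>. \<phi> (translated_point x y \<theta>) \<partial>angular_measure \<alpha>)
    = (\<integral>\<theta>. (c * sin \<theta> powr (2 * \<alpha>)) *\<^sub>R \<phi> (translated_point x y \<theta>) \<partial>restrict_space lborel {0<..<pi})"
    unfolding angular_measure_def c_def[symmetric] using \<open>c \<ge> 0\<close>
    by (intro integral_density[OF m w]) auto
  also have "\<dots> = (LINT \<theta>:{0<..<pi}|lborel. (c * sin \<theta> powr (2 * \<alpha>)) *\<^sub>R \<phi> (translated_point x y \<theta>))"
    unfolding set_lebesgue_integral_def by (rule integral_restrict_space) simp
  also have "\<dots> = (LINT \<theta>:{0<..<pi}|lborel. complex_of_real c
      * (\<phi> (translated_point x y \<theta>) * complex_of_real (sin \<theta> powr (2 * \<alpha>))))"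
    by (simp add: scaleR_conv_of_real mult_ac)
  also have "\<dots> = complex_of_real c * (LINT \<theta>:{0<..<pi}|lborel. \<phi> (translated_point x y \<theta>)
      * complex_of_real (sin \<theta> powr (2 * \<alpha>)))"
    by (rule set_integral_mult_right)
  also have "(LINT \<theta>:{0<..<pi}|lborel. \<phi> (translated_point x y \<theta>) * complex_of_real (sin \<theta> powr (2 * \<alpha>)))
    = (LBINT \<theta>=0..pi. \<phi> (translated_point x y \<theta>) * complex_of_real (sin \<theta> powr (2 * \<alpha>)))"
    by (simp add: interval_lebesgue_integral_def zero_ereal_def)
  finally show ?thesis by (simp add: weinstein_translation_def translated_point_def c_def)
qed

text \<open>
  In the first \<open>d\<close> coordinates this is invariance of Lebesgue measure under the shift by \<open>x'\<close>, in the
  last one it is the invariance of the radial measure from \<open>nn_integral_radial_translation\<close>.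
\<close>

lemma nn_integral_translated_point:
  fixes g :: "'d::finite hpoint \<Rightarrow> ennreal"
  assumes \<alpha>: "\<alpha> > - 1 / 2" and x: "x \<in> half_space" and g[measurable]: "g
      \<in> borel_measurable (weinstein_measure \<alpha>)"
  shows "(\<integral>\<^sup>+\<theta>. \<integral>\<^sup>+y. g (translated_point x y \<theta>) \<partial>weinstein_measure \<alpha> \<partial>angular_measure \<alpha>)
    = (\<integral>\<^sup>+y. g y \<partial>weinstein_measure \<alpha>)"
proof -
  \<comment> \<open>Outside the half-space \<open>g\<close> is unconstrained; cutting it off there gives a Borel function on the whole
      space.\<close>
  define G where "G = (\<lambda>y. g y * indicator half_space y)"
  have G[measurable]: "G \<in> borel_measurable borel"
    using g unfolding G_def measurable_cong_sets[OF sets_weinstein_measure refl]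
    by (subst (asm) borel_measurable_restrict_space_iff_ennreal) auto
  have gG: "g y = G y" if "y \<in> half_space" for y using that by (simp add: G_def)
  have G2[measurable]: "(\<lambda>w. G (u w, t w)) \<in> borel_measurable M"
    if [measurable]: "u \<in> M \<rightarrow>\<^sub>M borel" "t \<in> M \<rightarrow>\<^sub>M borel" for u t and M :: "'m measure"
    by (rule measurable_compose[OF _ G]) (simp add: borel_prod[symmetric])
  define \<rho> where "\<rho> = (\<lambda>t \<theta>. sqrt ((snd x)\<^sup>2 + t\<^sup>2 + 2 * snd x * t * cos \<theta>))"
  have [measurable]: "case_prod \<rho> \<in> borel_measurable (borel \<Otimes>\<^sub>M borel)"
    unfolding \<rho>_def by measurable
  define w where "w = (\<lambda>t. indicator {0<..} t * ennreal (t powr (2 * \<alpha> + 1)) :: ennreal)"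
  define v where "v = (\<lambda>\<theta>. indicator {0<..<pi} \<theta> * ennreal (sin \<theta> powr (2 * \<alpha>)) :: ennreal)"
  have [measurable]: "w \<in> borel_measurable borel" "v \<in> borel_measurable borel"
    unfolding w_def v_def by measurable
  define K where "K = ennreal (1 / weinstein_const \<alpha> CARD('d))"
  define c where "c = ennreal (Gamma (\<alpha> + 1) / (sqrt pi * Gamma (\<alpha> + 1 / 2)))"
  have weinstein: "(\<integral>\<^sup>+y. F y \<partial>weinstein_measure \<alpha>) = K * (\<integral>\<^sup>+y'. \<integral>\<^sup>+t. w t * F (y', t) \<partial>lborel \<partial>lborel)"
    if "F \<in> borel_measurable borel" for F :: "'d hpoint \<Rightarrow> ennreal"
    using nn_integral_weinstein_measure[OF that] by (simp add: K_def w_def)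
  define I where "I = (\<lambda>\<theta>. \<integral>\<^sup>+y'. \<integral>\<^sup>+t. w t * G (y', \<rho> t \<theta>) \<partial>lborel \<partial>lborel)"
  have [measurable]: "I \<in> borel_measurable borel" unfolding I_def by measurable
  have "(\<integral>\<^sup>+\<theta>. \<integral>\<^sup>+y. g (translated_point x y \<theta>) \<partial>weinstein_measure \<alpha> \<partial>angular_measure \<alpha>)
    = (\<integral>\<^sup>+\<theta>. K * I \<theta> \<partial>angular_measure \<alpha>)"
  proof (rule nn_integral_cong)
    fix \<theta> assume \<theta>: "\<theta> \<in> space (angular_measure \<alpha>)"
    have [measurable]: "\<rho> t \<in> borel_measurable borel" "(\<lambda>t. \<rho> t \<theta>) \<in> borel_measurable borel" for t
      unfolding \<rho>_def by measurable
    have "(\<integral>\<^sup>+y. g (translated_point x y \<theta>) \<partial>weinstein_measure \<alpha>) =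
        (\<integral>\<^sup>+y. G (fst x + fst y, \<rho> (snd y) \<theta>) \<partial>weinstein_measure \<alpha>)"
    proof (rule nn_integral_cong)
      fix y assume "y \<in> space (weinstein_measure \<alpha> :: 'd hpoint measure)"
      then have "translated_point x y \<theta> \<in> half_space"
        using \<theta> x by (intro translated_point_in_half_space) auto
      then show "g (translated_point x y \<theta>) = G (fst x + fst y, \<rho> (snd y) \<theta>)"
        by (simp add: gG) (simp add: translated_point_def \<rho>_def)
    qed
    also have "\<dots> = K * (\<integral>\<^sup>+y'. \<integral>\<^sup>+t. w t * G (fst x + y', \<rho> t \<theta>) \<partial>lborel \<partial>lborel)"
      by (subst weinstein) auto
    also have "(\<integral>\<^sup>+y'. \<integral>\<^sup>+t. w t * G (fst x + y', \<rho> t \<theta>) \<partial>lborel \<partial>lborel) = I \<theta>"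
      unfolding I_def
      by (rule nn_integral_lborel_translate[of "\<lambda>y'. \<integral>\<^sup>+t. w t * G (y', \<rho> t \<theta>) \<partial>lborel" "fst x"]) measurable
    finally show "(\<integral>\<^sup>+y. g (translated_point x y \<theta>) \<partial>weinstein_measure \<alpha>) = K * I \<theta>" .
  qed
  also have "\<dots> = c * (\<integral>\<^sup>+\<theta>. v \<theta> * (K * I \<theta>) \<partial>lborel)"
    by (subst nn_integral_angular_measure[OF \<alpha>]) (simp_all add: c_def v_def)
  also have "(\<integral>\<^sup>+\<theta>. v \<theta> * (K * I \<theta>) \<partial>lborel) = K * (\<integral>\<^sup>+\<theta>. v \<theta> * I \<theta> \<partial>lborel)"
    by (subst nn_integral_cmult[symmetric]) (auto simp: mult_ac)
  also have "(\<integral>\<^sup>+\<theta>. v \<theta> * I \<theta> \<partial>lborel) = (\<integral>\<^sup>+\<theta>. \<integral>\<^sup>+y'. \<integral>\<^sup>+t. w t * v \<theta> * G (y', \<rho> t \<theta>) \<partial>lborel \<partial>lborel \<partial>lborel)"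
    unfolding I_def by (simp add: nn_integral_cmult[symmetric] mult_ac)
  also have "\<dots> = (\<integral>\<^sup>+y'. \<integral>\<^sup>+\<theta>. \<integral>\<^sup>+t. w t * v \<theta> * G (y', \<rho> t \<theta>) \<partial>lborel \<partial>lborel \<partial>lborel)"
    by (rule lborel_pair.Fubini') measurable
  also have "\<dots> = (\<integral>\<^sup>+y'. \<integral>\<^sup>+t. \<integral>\<^sup>+\<theta>. w t * v \<theta> * G (y', \<rho> t \<theta>) \<partial>lborel \<partial>lborel \<partial>lborel)"
    by (intro nn_integral_cong lborel_pair.Fubini') measurable
  also have "\<dots> = (\<integral>\<^sup>+y'. (\<integral>\<^sup>+\<theta>. v \<theta> \<partial>lborel) * (\<integral>\<^sup>+t. w t * G (y', t) \<partial>lborel) \<partial>lborel)"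
  proof (rule nn_integral_cong)
    fix y' :: "real ^ 'd"
    have "(\<lambda>t. G (y', t)) \<in> borel_measurable borel" by measurable
    from nn_integral_radial_translation[OF this, of \<alpha> "snd x"]
    show "(\<integral>\<^sup>+t. \<integral>\<^sup>+\<theta>. w t * v \<theta> * G (y', \<rho> t \<theta>) \<partial>lborel \<partial>lborel) = (\<integral>\<^sup>+\<theta>. v \<theta> \<partial>lborel) *
        (\<integral>\<^sup>+t. w t * G (y', t) \<partial>lborel)"
      by (simp add: w_def v_def \<rho>_def mult.assoc)
  qed
  also have "\<dots> = (\<integral>\<^sup>+\<theta>. v \<theta> \<partial>lborel) * (\<integral>\<^sup>+y'. \<integral>\<^sup>+t. w t * G (y', t) \<partial>lborel \<partial>lborel)"
    by (rule nn_integral_cmult) measurable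
  also have "c * (K * ((\<integral>\<^sup>+\<theta>. v \<theta> \<partial>lborel) * (\<integral>\<^sup>+y'. \<integral>\<^sup>+t. w t * G (y', t) \<partial>lborel \<partial>lborel)))
    = (c * (\<integral>\<^sup>+\<theta>. v \<theta> \<partial>lborel)) * (K * (\<integral>\<^sup>+y'. \<integral>\<^sup>+t. w t * G (y', t) \<partial>lborel \<partial>lborel))"
    by (simp only: mult_ac)
  also have "c * (\<integral>\<^sup>+\<theta>. v \<theta> \<partial>lborel) = 1"
    using translation_const_normalizes[OF \<alpha>] by (simp add: c_def v_def)
  also have "1 * (K * (\<integral>\<^sup>+y'. \<integral>\<^sup>+t. w t * G (y', t) \<partial>lborel \<partial>lborel)) = (\<integral>\<^sup>+y. G y \<partial>weinstein_measure \<alpha>)"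
    by (subst weinstein) auto
  also have "\<dots> = (\<integral>\<^sup>+y. g y \<partial>weinstein_measure \<alpha>)"
    by (intro nn_integral_cong gG[symmetric]) simp
  finally show ?thesis .
qed

lemma finite_angular_measure:
  assumes "\<alpha> > - 1 / 2" shows "finite_measure (angular_measure \<alpha>)"
  using emeasure_angular_measure[OF assms] by (intro finite_measureI) simp

text \<open>
  Averaging over the probability measure of the angles does not increase the norm of
  \<open>(\<theta>, y) \<mapsto> f (translated_point x y \<theta>)\<close>, and that norm is at most the norm of \<open>f\<close> because the underlying
  map preserves the measure.
\<close>

lemma weinstein_translation_contraction:
  fixes f :: "'d::finite hpoint \<Rightarrow> complex"
  assumes \<alpha>: "\<alpha> > - 1 / 2" and x: "x \<in> half_space" and p: "1 \<le> p"
    and f: "f \<in> borel_measurable (weinstein_measure \<alpha>)" "Lp_norm (weinstein_measure \<alpha>) p f \<le> ennreal B" "0 \<le> B"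
  shows "Lp_norm (weinstein_measure \<alpha>) p (weinstein_translation \<alpha> x f) \<le> ennreal B"
    and "weinstein_translation \<alpha> x f \<in> borel_measurable (weinstein_measure \<alpha>)"
proof -
  let ?H = "weinstein_measure \<alpha> :: 'd hpoint measure" and ?\<Theta> = "angular_measure \<alpha>"
  interpret H: sigma_finite_measure ?H by (rule sigma_finite_weinstein_measure)
  interpret \<Theta>: finite_measure ?\<Theta> by (rule finite_angular_measure[OF \<alpha>])
  have s: "(\<lambda>w. translated_point x (snd w) (fst w)) \<in> ?\<Theta> \<Otimes>\<^sub>M ?H \<rightarrow>\<^sub>M ?H"
    by (rule measurable_translated_point[where \<alpha>=\<alpha> and \<beta>=\<alpha> and \<gamma>=\<alpha>]) (use x in auto)
  have s': "(\<lambda>w. translated_point x (fst w) (snd w)) \<in> ?H \<Otimes>\<^sub>M ?\<Theta> \<rightarrow>\<^sub>M ?H"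
    by (rule measurable_translated_point[where \<alpha>=\<alpha> and \<beta>=\<alpha> and \<gamma>=\<alpha>]) (use x in auto)
  define h where "h = (\<lambda>\<theta> y. f (translated_point x y \<theta>))"
  have h: "case_prod h \<in> borel_measurable (?\<Theta> \<Otimes>\<^sub>M ?H)"
    using measurable_compose[OF s f(1)] by (simp add: h_def case_prod_beta')
  have preserve: "(\<integral>\<^sup>+w. g (translated_point x (snd w) (fst w)) \<partial>(?\<Theta> \<Otimes>\<^sub>M ?H)) = ennreal 1 * (\<integral>\<^sup>+y. g y \<partial>?H)"
    if g: "g \<in> borel_measurable ?H" for g
    using nn_integral_translated_point[OF \<alpha> x g] H.nn_integral_fst[OF measurable_compose[OF s g]] by simp
  have "Lp_norm (?\<Theta> \<Otimes>\<^sub>M ?H) p (case_prod h) \<le> ennreal (1 powr (1 / enn2real p) * B)"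
    using Lp_norm_pullback_le[OF s f(1) p _ preserve f(2,3)] by (simp add: h_def case_prod_beta')
  then have "Lp_norm (?\<Theta> \<Otimes>\<^sub>M ?H) p (case_prod h) \<le> ennreal B" by simp
  from Lp_norm_integral_le(2)[OF sigma_finite_weinstein_measure p _ _ h this f(3), of 1]
  have "Lp_norm ?H p (\<lambda>y. \<integral>\<theta>. h \<theta> y \<partial>?\<Theta>) \<le> ennreal B"
    using emeasure_angular_measure[OF \<alpha>] by simp
  moreover have eq: "weinstein_translation \<alpha> x f y = (\<integral>\<theta>. h \<theta> y \<partial>?\<Theta>)" if "y \<in> space ?H" for y
    using weinstein_translation_eq_angular_mean[OF \<alpha> f(1) x] that by (simp add: h_def)
  ultimately show "Lp_norm ?H p (weinstein_translation \<alpha> x f) \<le> ennreal B"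
    using Lp_norm_cong[of ?H, OF eq] by simp
  have "(\<lambda>(y, \<theta>). h \<theta> y) \<in> borel_measurable (?H \<Otimes>\<^sub>M ?\<Theta>)"
    using measurable_compose[OF s' f(1)] by (simp add: h_def case_prod_beta')
  then have "(\<lambda>y. \<integral>\<theta>. h \<theta> y \<partial>?\<Theta>) \<in> borel_measurable ?H"
    by (rule \<Theta>.borel_measurable_lebesgue_integral)
  then show "weinstein_translation \<alpha> x f \<in> borel_measurable ?H"
    using measurable_cong[of ?H "weinstein_translation \<alpha> x f", OF eq] by simp
qed

section \<open>Norms of the atoms\<close>

lemma measurable_half_space_scaleR:
  assumes A: "A \<in> M \<rightarrow>\<^sub>M restrict_space borel {0<..}" and Y: "Y \<in> M \<rightarrow>\<^sub>M weinstein_measure \<alpha>"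
  shows "(\<lambda>w. Y w /\<^sub>R A w) \<in> M \<rightarrow>\<^sub>M (weinstein_measure \<alpha> :: 'd::finite hpoint measure)"
proof -
  have id_H: "(\<lambda>x. x) \<in> weinstein_measure \<alpha> \<rightarrow>\<^sub>M (borel :: 'd hpoint measure)"
    unfolding measurable_cong_sets[OF sets_weinstein_measure refl] by (rule measurable_restrict_space1) simp
  have id_A: "(\<lambda>a. a) \<in> restrict_space borel {0<..} \<rightarrow>\<^sub>M (borel :: real measure)"
    by (rule measurable_restrict_space1) simp
  have [measurable]: "A \<in> M \<rightarrow>\<^sub>M borel" "Y \<in> M \<rightarrow>\<^sub>M borel"
    using measurable_compose[OF A id_A] measurable_compose[OF Y id_H] by simp_all
  have "(\<lambda>w. Y w /\<^sub>R A w) \<in> M \<rightarrow>\<^sub>M borel" by measurable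
  moreover have "Y w /\<^sub>R A w \<in> half_space" if "w \<in> space M" for w
    using measurable_space[OF A that] measurable_space[OF Y that]
    by (auto simp: half_space_def space_restrict_space)
  ultimately show ?thesis
    unfolding measurable_cong_sets[OF refl sets_weinstein_measure]
    by (intro measurable_restrict_space2) auto
qed

lemma measurable_weinstein_dilation:
  fixes f :: "'d::finite hpoint \<Rightarrow> complex"
  assumes a: "0 < a" and f: "f \<in> borel_measurable (weinstein_measure \<alpha>)"
  shows "weinstein_dilation \<alpha> a f \<in> borel_measurable (weinstein_measure \<alpha>)"
proof -
  have "(\<lambda>y. y /\<^sub>R a) \<in> weinstein_measure \<alpha> \<rightarrow>\<^sub>M (weinstein_measure \<alpha> :: 'd hpoint measure)"
    by (rule measurable_half_space_scaleR) (use a in \<open>auto intro!: measurable_restrict_space2\<close>)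
  from measurable_compose[OF this f] show ?thesis
    unfolding weinstein_dilation_def[abs_def] by measurable
qed

lemma Lp_norm_weinstein_dilation_le:
  fixes f :: "'d::finite hpoint \<Rightarrow> complex"
  assumes a: "0 < a" and p: "1 \<le> p"
    and f: "f \<in> borel_measurable (weinstein_measure \<alpha>)" "Lp_norm (weinstein_measure \<alpha>) p f \<le> ennreal B" "0 \<le> B"
  defines "\<kappa> \<equiv> 2 * \<alpha> + real CARD('d) + 2"
  shows "Lp_norm (weinstein_measure \<alpha>) p (weinstein_dilation \<alpha> a f) \<le> ennreal (a powr (\<kappa> / enn2real p - \<kappa>) * B)"
proof -
  let ?H = "weinstein_measure \<alpha> :: 'd hpoint measure"
  have s: "(\<lambda>y. y /\<^sub>R a) \<in> ?H \<rightarrow>\<^sub>M ?H"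
    by (rule measurable_half_space_scaleR) (use a in \<open>auto intro!: measurable_restrict_space2\<close>)
  have m: "(\<lambda>y. f (y /\<^sub>R a)) \<in> borel_measurable ?H" by (rule measurable_compose[OF s f(1)])
  have "Lp_norm ?H p (\<lambda>y. f (y /\<^sub>R a)) \<le> ennreal ((a powr \<kappa>) powr (1 / enn2real p) * B)"
    using a by (intro Lp_norm_pullback_le[OF s f(1) p _ _ f(2,3)])
      (simp_all add: nn_integral_weinstein_dilate \<kappa>_def)
  from Lp_norm_cmult_le[OF m p this, of "complex_of_real (a powr (- \<kappa>))"]
  have "Lp_norm ?H p (\<lambda>y. complex_of_real (a powr (- \<kappa>)) * f (y /\<^sub>R a))
      \<le> ennreal (a powr (- \<kappa>) * ((a powr \<kappa>) powr (1 / enn2real p) * B))"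
    using f(3) by simp
  also have "a powr (- \<kappa>) * ((a powr \<kappa>) powr (1 / enn2real p) * B) = a powr (\<kappa> / enn2real p - \<kappa>) * B"
    by (simp add: powr_powr mult.assoc[symmetric] powr_add[symmetric])
  finally show ?thesis
    by (simp add: weinstein_dilation_def[abs_def] \<kappa>_def)
qed

text \<open>
  The exponent vanishes at \<open>p = 2\<close>: the atoms are normalized in \<open>L\<^sup>2\<close>. For conjugate exponents the
  exponents are opposite, which is what makes the localization bound independent of the scale.
\<close>

lemma Lp_norm_weinstein_atom_le:
  fixes f :: "'d::finite hpoint \<Rightarrow> complex"
  assumes \<alpha>: "\<alpha> > - 1 / 2" and a: "0 < a" and x: "x \<in> half_space" and p: "1 \<le> p"
    and f: "f \<in> borel_measurable (weinstein_measure \<alpha>)" "Lp_norm (weinstein_measure \<alpha>) p f \<le> ennreal B" "0 \<le> B"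
  defines "\<kappa> \<equiv> 2 * \<alpha> + real CARD('d) + 2"
  shows "Lp_norm (weinstein_measure \<alpha>) p (weinstein_atom \<alpha> f a x)
      \<le> ennreal (a powr (\<kappa> / enn2real p - \<kappa> / 2) * B)"
proof -
  let ?H = "weinstein_measure \<alpha> :: 'd hpoint measure"
  note d = Lp_norm_weinstein_dilation_le[OF a p f, folded \<kappa>_def]
  note t = weinstein_translation_contraction[OF \<alpha> x p measurable_weinstein_dilation[OF a f(1)] d]
  have "Lp_norm ?H p (\<lambda>y. complex_of_real (a powr (\<kappa> / 2))
      * weinstein_translation \<alpha> x (weinstein_dilation \<alpha> a f) y)
     \<le> ennreal (norm (complex_of_real (a powr (\<kappa> / 2))) * (a powr (\<kappa> / enn2real p - \<kappa>) * B))"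
    using f(3) by (intro Lp_norm_cmult_le p t) auto
  also have "norm (complex_of_real (a powr (\<kappa> / 2))) * (a powr (\<kappa> / enn2real p - \<kappa>) * B)
      = a powr (\<kappa> / enn2real p - \<kappa> / 2) * B"
    by (simp add: mult.assoc[symmetric] powr_add[symmetric])
  finally show ?thesis
    unfolding weinstein_atom_def[abs_def] by (simp add: \<kappa>_def add_divide_distrib algebra_simps)
qed

text \<open>
  Joint measurability in scale, position and argument is what Tonelli's theorem requires in the
  superposition. It holds because on the relevant space the atom is a power of the scale times an integral
  over the angle of a jointly measurable function.
\<close>

lemma measurable_weinstein_atom:
  fixes f :: "'d::finite hpoint \<Rightarrow> complex"
  assumes \<alpha>: "\<alpha> > - 1 / 2" and f: "f \<in> borel_measurable (weinstein_measure \<alpha>)"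
  shows "(\<lambda>(z, y). weinstein_atom \<alpha> f (fst z) (snd z) y)
    \<in> borel_measurable (weinstein_scale_measure \<alpha> \<Otimes>\<^sub>M weinstein_measure \<alpha>)"
proof -
  let ?H = "weinstein_measure \<alpha> :: 'd hpoint measure" and ?N
      = "weinstein_scale_measure \<alpha> :: (real \<times> 'd hpoint) measure"
    and ?\<Theta> = "angular_measure \<alpha>"
  define P where "P = ?N \<Otimes>\<^sub>M ?H"
  interpret \<Theta>: finite_measure ?\<Theta> by (rule finite_angular_measure[OF \<alpha>])
  have id_A: "(\<lambda>a. a) \<in> restrict_space borel {0<..} \<rightarrow>\<^sub>M (borel :: real measure)"
    by (rule measurable_restrict_space1) simp
  have fst_N: "fst \<in> ?N \<rightarrow>\<^sub>M restrict_space borel {0<..}" and snd_N: "snd \<in> ?N \<rightarrow>\<^sub>M ?H"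
    unfolding measurable_cong_sets[OF sets_weinstein_scale_measure refl] by measurable
  have A: "(\<lambda>w. fst (fst w)) \<in> P \<rightarrow>\<^sub>M restrict_space borel {0<..}"
    and X: "(\<lambda>w. snd (fst w)) \<in> P \<rightarrow>\<^sub>M ?H" and Y: "(\<lambda>w. snd w) \<in> P \<rightarrow>\<^sub>M ?H"
    unfolding P_def by (auto intro!: measurable_compose[OF measurable_fst fst_N] measurable_compose[OF
        measurable_fst snd_N])
  have [measurable]: "(\<lambda>w. fst (fst w)) \<in> borel_measurable P"
    using measurable_compose[OF A id_A] by simp
  have "(\<lambda>u. translated_point (snd (fst (fst u))) (snd (fst u)) (snd u)) \<in> P \<Otimes>\<^sub>M ?\<Theta> \<rightarrow>\<^sub>M ?H"
    by (rule measurable_translated_point[where \<alpha>=\<alpha> and \<beta>=\<alpha> and \<gamma>=\<alpha>])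
      (auto intro!: measurable_compose[OF measurable_fst X] measurable_compose[OF measurable_fst Y])
  then have "(\<lambda>u. translated_point (snd (fst (fst u))) (snd (fst u)) (snd u) /\<^sub>R fst (fst (fst u)))
      \<in> P \<Otimes>\<^sub>M ?\<Theta> \<rightarrow>\<^sub>M ?H"
    by (intro measurable_half_space_scaleR measurable_compose[OF measurable_fst A])
  from measurable_compose[OF this f]
  have [measurable]: "(\<lambda>(w, \<theta>). f (translated_point (snd (fst w)) (snd w) \<theta> /\<^sub>R fst (fst w)))
      \<in> borel_measurable (P \<Otimes>\<^sub>M ?\<Theta>)"
    by (simp add: case_prod_beta')
  have "(\<lambda>w. complex_of_real (fst (fst w) powr (\<alpha> + 1 + real CARD('d) / 2)) *
      (complex_of_real (fst (fst w) powr (- (2 * \<alpha> + real CARD('d) + 2))) *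
        (\<integral>\<theta>. f (translated_point (snd (fst w)) (snd w) \<theta> /\<^sub>R fst (fst w)) \<partial>?\<Theta>))) \<in> borel_measurable P"
    by measurable
  moreover have "(\<lambda>w. complex_of_real (fst (fst w) powr (\<alpha> + 1 + real CARD('d) / 2)) *
      (complex_of_real (fst (fst w) powr (- (2 * \<alpha> + real CARD('d) + 2))) *
        (\<integral>\<theta>. f (translated_point (snd (fst w)) (snd w) \<theta> /\<^sub>R fst (fst w)) \<partial>?\<Theta>))) \<in> borel_measurable P
    \<longleftrightarrow> (\<lambda>(z, y). weinstein_atom \<alpha> f (fst z) (snd z) y) \<in> borel_measurable P"
  proof (rule measurable_cong)
    fix w assume "w \<in> space P"
    then obtain a x y where w: "w = ((a, x), y)" "a > 0" "x \<in> half_space" "y \<in> half_space"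
      by (auto simp: P_def space_pair_measure)
    have dm: "weinstein_dilation \<alpha> a f \<in> borel_measurable ?H"
      by (rule measurable_weinstein_dilation[OF w(2) f])
    show "complex_of_real (fst (fst w) powr (\<alpha> + 1 + real CARD('d) / 2)) *
      (complex_of_real (fst (fst w) powr (- (2 * \<alpha> + real CARD('d) + 2))) *
        (\<integral>\<theta>. f (translated_point (snd (fst w)) (snd w) \<theta> /\<^sub>R fst (fst w)) \<partial>?\<Theta>))
      = (case w of (z, y) \<Rightarrow> weinstein_atom \<alpha> f (fst z) (snd z) y)"
      using w by (simp add: weinstein_atom_def weinstein_translation_eq_angular_mean[OF \<alpha> dm])
        (simp add: weinstein_dilation_def)
  qed
  ultimately show ?thesis by (simp add: P_def)
qed

section \<open>Boundedness of the localization operator\<close>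

theorem theorem3p7:
  fixes \<alpha> :: real and p q :: ennreal
    and \<sigma> :: "real \<times> 'd::finite hpoint \<Rightarrow> complex"
    and \<phi> \<psi> :: "'d hpoint \<Rightarrow> complex"
  assumes "\<alpha> > - 1 / 2"
    and "1 \<le> p" and "1 / p + 1 / q = 1"
    and "\<sigma> \<in> Lp (weinstein_scale_measure \<alpha>) 1"
    and "\<psi> \<in> Lp (weinstein_measure \<alpha>) p"
    and "\<phi> \<in> Lp (weinstein_measure \<alpha>) q"
  shows "(\<forall>f \<in> Lp (weinstein_measure \<alpha>) p. AE y in weinstein_measure \<alpha>.
            integrable (weinstein_scale_measure \<alpha>) (localization_integrand \<alpha> \<phi> \<psi> \<sigma> f y)) \<and>
         Lp_bounded_linear_operator (weinstein_measure \<alpha>) p (localization_operator \<alpha> \<phi> \<psi> \<sigma>) \<and>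
         Lp_operator_norm (weinstein_measure \<alpha>) p (localization_operator \<alpha> \<phi> \<psi> \<sigma>)
         \<le> Lp_norm (weinstein_measure \<alpha>) q \<phi> * Lp_norm (weinstein_measure \<alpha>) p \<psi> *
           Lp_norm (weinstein_scale_measure \<alpha>) 1 \<sigma>"
proof -
  let ?H = "weinstein_measure \<alpha> :: 'd hpoint measure" and ?N
      = "weinstein_scale_measure \<alpha> :: (real \<times> 'd hpoint) measure"
  let ?T = "localization_operator \<alpha> \<phi> \<psi> \<sigma>" and ?k = "localization_integrand \<alpha> \<phi> \<psi> \<sigma>"
  have pq: "conjugate_exponents p q" using assms by (intro conjugate_exponentsI)
  then have p: "1 \<le> p" and q: "1 \<le> q" and pq1: "1 / enn2real p + 1 / enn2real q = 1"
    by (auto simp: conjugate_exponents_def)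
  have [measurable]: "\<sigma> \<in> borel_measurable ?N" "\<psi> \<in> borel_measurable ?H" "\<phi> \<in> borel_measurable ?H"
    using assms by (auto simp: Lp_def)
  have real_norm: "\<exists>B. Lp_norm M r g = ennreal B \<and> 0 \<le> B" if "g \<in> Lp M r" for g r and M :: "'m measure"
    using that by (cases "Lp_norm M r g") (auto simp: Lp_def)
  obtain S where S: "Lp_norm ?N 1 \<sigma> = ennreal S" "0 \<le> S" using real_norm[OF assms(4)] by blast
  obtain B where B: "Lp_norm ?H p \<psi> = ennreal B" "0 \<le> B" using real_norm[OF assms(5)] by blast
  obtain C where C: "Lp_norm ?H q \<phi> = ennreal C" "0 \<le> C" using real_norm[OF assms(6)] by blast
  define \<kappa> where "\<kappa> = 2 * \<alpha> + real CARD('d) + 2"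
  define u where "u = (\<lambda>z. weinstein_atom \<alpha> \<phi> (fst z) (snd z))"
  define v where "v = (\<lambda>z. weinstein_atom \<alpha> \<psi> (fst z) (snd z))"
  define U where "U = (\<lambda>z :: real \<times> 'd hpoint. fst z powr (\<kappa> / enn2real q - \<kappa> / 2) * C)"
  define V where "V = (\<lambda>z :: real \<times> 'd hpoint. fst z powr (\<kappa> / enn2real p - \<kappa> / 2) * B)"
  have um: "case_prod u \<in> borel_measurable (?N \<Otimes>\<^sub>M ?H)" and vm: "case_prod v \<in> borel_measurable (?N \<Otimes>\<^sub>M ?H)"
    unfolding u_def v_def by (rule measurable_weinstein_atom[OF assms(1)], simp)+
  have u: "Lp_norm ?H q (u z) \<le> ennreal (U z)" if "z \<in> space ?N" for z
    unfolding u_def U_def \<kappa>_def using that C q by (intro Lp_norm_weinstein_atom_le[OF assms(1)]) auto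
  have v: "Lp_norm ?H p (v z) \<le> ennreal (V z)" if "z \<in> space ?N" for z
    unfolding v_def V_def \<kappa>_def using that B p by (intro Lp_norm_weinstein_atom_le[OF assms(1)]) auto
  have nonneg: "0 \<le> U z" "0 \<le> V z" for z using B C by (auto simp: U_def V_def)
  have UV: "U z * V z \<le> C * B" if "z \<in> space ?N" for z
  proof -
    have a: "fst z > 0" using that by auto
    have "\<kappa> / enn2real q - \<kappa> / 2 + (\<kappa> / enn2real p - \<kappa> / 2) = \<kappa> * (1 / enn2real p + 1 / enn2real q - 1)"
      by (simp add: algebra_simps)
    also have "\<dots> = 0" using pq1 by simp
    finally have "fst z powr (\<kappa> / enn2real q - \<kappa> / 2) * fst z powr (\<kappa> / enn2real p - \<kappa> / 2) = 1"
      using a by (simp add: powr_add[symmetric])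
    then have "U z * V z = C * B" unfolding U_def V_def by algebra
    then show ?thesis by simp
  qed
  have k_eq: "?k f y = (\<lambda>z. \<sigma> z * (\<integral>x. f x * cnj (u z x) \<partial>?H) * v z y)" for f y
    by (rule ext) (simp add: localization_integrand_def weinstein_wavelet_transform_def u_def v_def
        case_prod_beta')
  have T_eq: "?T f = (\<lambda>y. \<integral>z. ?k f y z \<partial>?N)" for f
    by (rule ext) (simp add: localization_operator_def)
  have uz: "u z \<in> borel_measurable ?H" if "z \<in> space ?N" for z
    using measurable_Pair2[OF um that] by simp
  have CB: "0 \<le> C * B" using B C by simp
  have main: "AE y in ?H. integrable ?N (?k f y)" "Lp_norm ?H p (?T f) \<le> ennreal (S * (A * (C * B)))"
      "?T f \<in> borel_measurable ?H"
    if f: "f \<in> borel_measurable ?H" and A: "Lp_norm ?H p f \<le> ennreal A" "0 \<le> A" for f A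
    using Lp_norm_superposition_le[OF sigma_finite_weinstein_measure sigma_finite_weinstein_scale_measure pq
        um vm _ f
        S(1)[unfolded Lp_norm_1] S(2) u nonneg(1) v nonneg(2) UV CB A]
    unfolding T_eq k_eq by simp_all
  have bound: "Lp_norm ?H p (?T f) \<le> ennreal (C * B * S) * Lp_norm ?H p f" if f: "f \<in> Lp ?H p" for f
  proof -
    obtain A where A: "Lp_norm ?H p f = ennreal A" "0 \<le> A" using real_norm[OF f] by blast
    have "Lp_norm ?H p (?T f) \<le> ennreal (S * (A * (C * B)))"
      using main(2)[of f A] f A by (auto simp: Lp_def)
    also have "S * (A * (C * B)) = C * B * S * A" by simp
    also have "ennreal (C * B * S * A) = ennreal (C * B * S) * Lp_norm ?H p f"
      using A B C S by (simp add: ennreal_mult)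
    finally show ?thesis .
  qed
  have integrable_k: "AE y in ?H. integrable ?N (?k f y)" if f: "f \<in> Lp ?H p" for f
  proof -
    obtain A where "Lp_norm ?H p f = ennreal A" "0 \<le> A" using real_norm[OF f] by blast
    then show ?thesis using main(1)[of f A] f by (auto simp: Lp_def)
  qed
  have T_mem: "?T f \<in> Lp ?H p" if f: "f \<in> Lp ?H p" for f
  proof -
    obtain A where A: "Lp_norm ?H p f = ennreal A" "0 \<le> A" using real_norm[OF f] by blast
    then have "Lp_norm ?H p (?T f) < \<infinity>"
      using main(2)[of f A] f by (auto simp: Lp_def intro: le_less_trans)
    then show ?thesis using main(3)[of f A] f A by (auto simp: Lp_def)
  qed
  have transform_integrable: "integrable ?H (\<lambda>x. f x * cnj (u z x))" if f: "f \<in> Lp ?H p" and z: "z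
      \<in> space ?N" for f z
  proof -
    obtain A where A: "Lp_norm ?H p f = ennreal A" "0 \<le> A" using real_norm[OF f] by blast
    show ?thesis
      using f A by (intro Lp_pairing_bound(1)[OF pq _ uz[OF z] _ _ u[OF z] nonneg(1)]) (auto simp: Lp_def)
  qed
  have T_cong: "?T f y = ?T g y" if f: "f \<in> Lp ?H p" and g: "g \<in> Lp ?H p" and eq: "AE x in ?H. f x = g x"
      for f g y
    unfolding T_eq
  proof (rule Bochner_Integration.integral_cong)
    fix z assume z: "z \<in> space ?N"
    have "(\<integral>x. f x * cnj (u z x) \<partial>?H) = (\<integral>x. g x * cnj (u z x) \<partial>?H)"
      using eq borel_measurable_integrable[OF transform_integrable[OF f z]] borel_measurable_integrable[OF
          transform_integrable[OF g z]]
      by (intro integral_cong_AE) auto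
    then show "?k f y z = ?k g y z" by (simp add: k_eq)
  qed simp
  have T_add: "AE y in ?H. ?T (\<lambda>x. f x + g x) y = ?T f y + ?T g y" if f: "f \<in> Lp ?H p" and g: "g \<in> Lp ?H p"
      for f g
    using integrable_k[OF f] integrable_k[OF g]
  proof eventually_elim
    case (elim y)
    have "?T (\<lambda>x. f x + g x) y = (\<integral>z. ?k f y z + ?k g y z \<partial>?N)"
      unfolding T_eq
    proof (rule Bochner_Integration.integral_cong)
      fix z assume z: "z \<in> space ?N"
      have "(\<integral>x. (f x + g x) * cnj (u z x) \<partial>?H) = (\<integral>x. f x * cnj (u z x) \<partial>?H) + (\<integral>x. g x * cnj (u z x) \<partial>?H)"
        using transform_integrable[OF f z] transform_integrable[OF g z] by (simp add: distrib_right)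
      then show "?k (\<lambda>x. f x + g x) y z = ?k f y z + ?k g y z" by (simp add: k_eq algebra_simps)
    qed simp
    then show ?case using elim by (simp add: T_eq)
  qed
  have T_cmult: "?T (\<lambda>x. c * f x) y = c * ?T f y" for f c y
  proof -
    have "(\<integral>x. c * f x * cnj (u z x) \<partial>?H) = c * (\<integral>x. f x * cnj (u z x) \<partial>?H)" for z
      by (simp only: mult.assoc integral_mult_right_zero)
    then have "?k (\<lambda>x. c * f x) y z = c * ?k f y z" for z
      by (simp add: k_eq)
    then have "?k (\<lambda>x. c * f x) y = (\<lambda>z. c * ?k f y z)" by (rule ext)
    then show ?thesis unfolding T_eq by (simp only: integral_mult_right_zero)
  qed
  have linear: "Lp_linear_operator ?H p ?T"
    unfolding Lp_linear_operator_def
  proof (intro conjI ballI allI impI)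
    show "?T f \<in> Lp ?H p" if "f \<in> Lp ?H p" for f by (rule T_mem[OF that])
    show "AE x in ?H. ?T f x = ?T g x" if "f \<in> Lp ?H p" "g \<in> Lp ?H p" "AE x in ?H. f x = g x" for f g
      by (rule AE_I2) (rule T_cong[OF that])
    show "AE x in ?H. ?T (\<lambda>y. f y + g y) x = ?T f x + ?T g x" if "f \<in> Lp ?H p" "g \<in> Lp ?H p" for f g
      by (rule T_add[OF that])
    show "AE x in ?H. ?T (\<lambda>y. c * f y) x = c * ?T f x" for f c
      by (rule AE_I2) (rule T_cmult)
  qed
  have "Lp_operator_norm ?H p ?T \<le> ennreal (C * B * S)"
    unfolding Lp_operator_norm_def
  proof (rule SUP_least)
    fix f assume f: "f \<in> {f \<in> Lp ?H p. Lp_norm ?H p f \<le> 1}"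
    have "Lp_norm ?H p (?T f) \<le> ennreal (C * B * S) * Lp_norm ?H p f" using bound f by auto
    also have "\<dots> \<le> ennreal (C * B * S) * 1" using f by (intro mult_left_mono) auto
    finally show "Lp_norm ?H p (?T f) \<le> ennreal (C * B * S)" by simp
  qed
  also have "ennreal (C * B * S) = Lp_norm ?H q \<phi> * Lp_norm ?H p \<psi> * Lp_norm ?N 1 \<sigma>"
    using B C S by (simp add: ennreal_mult)
  finally have "Lp_operator_norm ?H p ?T \<le> Lp_norm ?H q \<phi> * Lp_norm ?H p \<psi> * Lp_norm ?N 1 \<sigma>" .
  moreover have "Lp_bounded_linear_operator ?H p ?T"
    unfolding Lp_bounded_linear_operator_def using linear bound by blast
  ultimately show ?thesis using integrable_k by blast
qed

end
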